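(* For all $(t,q)\in D$, $$-t\log4+\log\zeta(2t-q)\le P(t,q)\le\log\zeta(2t-q).$$ Consequently: (1) $P(0,q)=\log\zeta(-q)$, and for any point $(t_0,q_0)$ on the line $2t-q=1$, $\lim_{(t,q)\to(t_0,q_0)}P(t,q)=\infty$; (2) for fixed $t\in\mathbb{R}$, $\lim_{q\to 2t-1}\frac{\partial P}{\partial q}(t,q)=+\infty$; (3) for fixed $t\in\mathbb{R}$, $\lim_{q\to-\infty}\frac{P(t,q)}q=0$ and $\lim_{q\to-\infty}\frac{\partial P}{\partial q}(t,q)=0$.
   Context: $D=\{(t,q)\in\mathbb{R}^2:2t-q>1\}$; $\zeta(s)=\sum_{n\ge1}n^{-s}$ for $s>1$. Write $[\omega_1,\dots,\omega_n+x]=\cfrac{1}{\omega_1+\cfrac{1}{\ddots+\cfrac{1}{\omega_n+x}}}$. For $(t,q)\in D$, $$P(t,q)=\lim_{n\to\infty}\frac1n\log\sum_{\omega_1=1}^\infty\cdots\sum_{\omega_n=1}^\infty\exp\Big(\sup_{x\in[0,1]}\log\prod_{j=1}^n\omega_j^q\,([\omega_j,\dots,\omega_n+x])^{2t}\Big),$$ a real-analytic function on $D$. Since $P$ is defined only on $D$, all values and limits are understood with $(t,q)\in D$ (so $q<-1$ in the formula for $P(0,q)$, and $q\to2t-1$ from below in (2)).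
   Formalization: The displayed bound is false for t<0, where its lower bound exceeds its upper bound; it is proved as printed for t≥0, and for t<0 it is replaced by log ζ(2t−q) ≤ P(t,q) ≤ −t log 4 + log ζ(2t−q). *)

theory Defs
  imports "HOL-Analysis.Analysis"
begin

definition D :: "(real \<times> real) set" where
  "D = {(t, q). 2 * t - q > 1}"

definition zeta :: "real \<Rightarrow> real" where
  "zeta s = (\<Sum>n. real (Suc n) powr (- s))"

(* cf [w_1, ..., w_n] x is the finite continued fraction [w_1, ..., w_n + x]. *)
fun cf :: "nat list \<Rightarrow> real \<Rightarrow> real" where
  "cf [] x = x"
| "cf (k # \<omega>) x = 1 / (real k + cf \<omega> x)"

definition words :: "nat \<Rightarrow> nat list set" where
  "words n = {\<omega>. length \<omega> = n \<and> (\<forall>k \<in> set \<omega>. 1 \<le> k)}"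

(* Digits are indexed from 0, so cf (drop j w) x is [w_(j+1), ..., w_n + x].
   All terms of the sum are positive, so the iterated sum over w_1, ..., w_n
   is rendered as the unordered sum over all words of length n. *)
definition partition_sum :: "nat \<Rightarrow> real \<Rightarrow> real \<Rightarrow> real" where
  "partition_sum n t q =
     (\<Sum>\<^sub>\<infinity> \<omega> \<in> words n.
        exp (SUP x \<in> {0..1}.
          ln (\<Prod>j<n. real (\<omega> ! j) powr q * cf (drop j \<omega>) x powr (2 * t))))"

definition P :: "real \<Rightarrow> real \<Rightarrow> real" where
  "P t q = lim (\<lambda>n. 1 / real n * ln (partition_sum n t q))"

end

theory Submission
  imports Defs
begin

text \<open>
  Let \<open>L\<^sub>q f x = (\<Sum>k\<ge>1. k powr q * (k + x) powr (- 2 * t) * f (1 / (k + x)))\<close> be the transfer operator of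
  the Gauss map. The \<open>n\<close>-th partition sum agrees with \<open>(L\<^sub>q ^^ n) 1 0\<close> up to a factor independent
  of \<open>n\<close>, which gives convergence (by subadditivity), the bounds by the zeta function
  (since \<open>k \<le> k + x \<le> 2 * k\<close>) and, by Hoelder's inequality, convexity of the pressure in \<open>q\<close>.

  Differentiability in \<open>q\<close> needs no spectral perturbation theory: for a convex function it follows from
  \<open>P (q + h) + P (q - h) - 2 * P q \<le> C * h\<^sup>2\<close>. To get this, follow a first-order correction \<open>v\<close> to
  the iterate \<open>f = (L\<^sub>q ^^ n) 1\<close>, so that
  \<open>(L\<^sub>q\<^sub>+\<^sub>h ^^ n) 1 \<le> exp (h * \<sigma> + n * C * h\<^sup>2) * (f + h * v)\<close> with the same \<open>\<sigma>\<close> for \<open>h\<close> and \<open>- h\<close>.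
  The correction stays between \<open>0\<close> and \<open>W * f\<close>, uniformly in \<open>n\<close>, in the order of a cone of functions of
  bounded logarithmic distortion, because \<open>L\<^sub>q\<close> maps this cone into a strictly smaller one
  (Birkhoff's contraction argument). The limits of the derivative are then read off the tangent
  inequality for convex functions.
\<close>

subsection \<open>Real analysis\<close>

text \<open>Fekete's lemma: the limit is the infimum of the quotients, and the lower bound
  \<open>c\<close> keeps that infimum finite.\<close>

lemma subadditive_convergent:
  fixes a :: "nat \<Rightarrow> real"
  assumes sub: "\<And>m n. a (m + n) \<le> a m + a n"
    and bdd: "\<And>n. 0 < n \<Longrightarrow> c \<le> a n / real n"
  shows "convergent (\<lambda>n. a n / real n)"
proof -
  define l where "l = (INF n\<in>{0<..}. a n / real n)"
  have bb: "bdd_below ((\<lambda>n. a n / real n) ` {0<..})"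
    using bdd by (auto intro!: bdd_belowI[of _ c])
  have lower: "l \<le> a n / real n" if "0 < n" for n
    unfolding l_def using that by (intro cINF_lower[OF bb]) auto
  have iter: "a (m * k + r) \<le> real k * a m + a r" for m k r
  proof (induction k)
    case (Suc k)
    have "a (m * Suc k + r) \<le> a m + a (m * k + r)"
      using sub[of m "m * k + r"] by (simp add: add.assoc)
    with Suc show ?case by (simp add: algebra_simps)
  qed simp
  have "(\<lambda>n. a n / real n) \<longlonglongrightarrow> l"
  proof (rule LIMSEQ_I)
    fix e :: real assume e: "0 < e"
    have "\<exists>m\<in>{0<..}. a m / real m < l + e / 2"
      unfolding l_def using e by (subst cINF_less_iff[OF _ bb, symmetric]) auto
    then obtain m where m: "0 < m" "a m / real m < l + e / 2" by auto
    \<comment> \<open>\<open>C\<close> bounds, uniformly in \<open>r < m\<close>, both leftovers of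
      the division \<open>n = m * k + r\<close>: the term \<open>a r\<close>, and the error made by
      replacing \<open>k * a m\<close> with \<open>n * (a m / m)\<close>.\<close>
    define C where "C = \<bar>a m\<bar> + (\<Sum>r<m. \<bar>a r\<bar>) + 1"
    have C: "0 < C" unfolding C_def by (intro add_nonneg_pos add_nonneg_nonneg sum_nonneg) auto
    obtain N :: nat where N: "2 * C / e < real N" using reals_Archimedean2 by blast
    show "\<exists>N. \<forall>n\<ge>N. norm (a n / real n - l) < e"
    proof (intro exI allI impI)
      fix n assume n: "N \<le> n"
      have "0 < 2 * C / e" using C e by simp
      with N n have Cn: "2 * C / e < real n" by (meson less_le_trans of_nat_le_iff)
      have npos: "0 < n" using Cn \<open>0 < 2 * C / e\<close> by (cases n) auto
      define k r where "k = n div m" and "r = n mod m"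
      have nkr: "n = m * k + r" and r: "r < m" using m by (auto simp: k_def r_def)
      have "a r \<le> (\<Sum>r<m. \<bar>a r\<bar>)"
        using member_le_sum[of r "{..<m}" "\<lambda>r. \<bar>a r\<bar>"] r by auto
      moreover have "real k * a m \<le> real n * (a m / real m) + \<bar>a m\<bar>"
      proof -
        have "real k * a m = real n * (a m / real m) - (real r / real m) * a m"
          using m by (simp add: nkr field_simps)
        moreover have "\<bar>(real r / real m) * a m\<bar> \<le> 1 * \<bar>a m\<bar>"
          unfolding abs_mult using r m by (intro mult_right_mono) auto
        ultimately show ?thesis by linarith
      qed
      ultimately have "a n \<le> real n * (a m / real m) + C"
        using iter[of m k r] unfolding nkr[symmetric] C_def by linarith
      then have "a n / real n \<le> a m / real m + C / real n"
        using npos by (simp add: field_simps)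
      moreover have "C / real n < e / 2"
        using Cn e npos by (simp add: field_simps)
      ultimately have "a n / real n < l + e" using m by linarith
      then show "norm (a n / real n - l) < e" using lower[OF npos] by simp
    qed
  qed
  then show ?thesis by (rule convergentI)
qed

text \<open>Young's inequality, applied termwise after dividing by the sums \<open>A\<close> and
  \<open>B\<close>; the dominating series \<open>g\<close> then adds up to exactly the right-hand
  side.\<close>

lemma suminf_Hoelder:
  fixes a b :: "nat \<Rightarrow> real"
  assumes a: "\<And>k. 0 < a k" "summable a" and b: "\<And>k. 0 < b k" "summable b"
    and u: "0 \<le> u" "u \<le> 1"
  shows "summable (\<lambda>k. a k powr (1 - u) * b k powr u)" (is "summable ?c")
    and "(\<Sum>k. a k powr (1 - u) * b k powr u) \<le> suminf a powr (1 - u) * suminf b powr u"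
proof -
  define A B where "A = suminf a" and "B = suminf b"
  have A: "0 < A" and B: "0 < B"
    using a b by (auto simp: A_def B_def intro!: suminf_pos)
  define M where "M = A powr (1 - u) * B powr u"
  have M: "0 < M" using A B by (simp add: M_def)
  define g where "g = (\<lambda>k. M * ((1 - u) * (a k / A) + u * (b k / B)))"
  have le: "?c k \<le> g k" for k
  proof -
    have "(a k / A) powr (1 - u) * (b k / B) powr u \<le> (1 - u) * (a k / A) + u * (b k / B)"
      using a b A B u by (intro Youngs_inequality_0) auto
    moreover have "?c k = M * ((a k / A) powr (1 - u) * (b k / B) powr u)"
      using a(1)[of k] b(1)[of k] A B by (simp add: M_def powr_divide)
    ultimately show ?thesis using M unfolding g_def by (simp add: mult_left_mono)
  qed
  have "g sums (M * ((1 - u) * (A / A) + u * (B / B)))"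
    unfolding g_def A_def B_def using a b
    by (intro sums_mult sums_add sums_divide summable_sums)
  then have g: "g sums M" using A B by simp
  show c: "summable ?c"
    using le by (intro summable_comparison_test'[OF sums_summable[OF g]]) auto
  show "suminf ?c \<le> suminf a powr (1 - u) * suminf b powr u"
    using suminf_le[OF le c sums_summable[OF g]] sums_unique[OF g] by (simp add: M_def A_def B_def)
qed

text \<open>Slopes of a convex function increase, so the infimum of the right slopes at
  \<open>x\<close> lies above every left slope. The second-difference bound makes the gap between
  the slopes for \<open>h\<close> and \<open>- h\<close> of order \<open>h\<close>, which squeezes
  both onto this infimum.\<close>

lemma convex_has_derivative_of_second_difference:
  fixes f :: "real \<Rightarrow> real"
  assumes convex: "convex_on {..<b} f" and x: "x < b" and r: "0 < r"
    and second: "\<And>h. 0 < h \<Longrightarrow> h < r \<Longrightarrow> f (x + h) + f (x - h) - 2 * f x \<le> C * h\<^sup>2"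
  shows "\<exists>D. (f has_real_derivative D) (at x)"
proof -
  define s where "s h = (f (x + h) - f x) / h" for h
  define \<delta> where "\<delta> = min r (b - x)"
  have \<delta>: "0 < \<delta>" "\<delta> \<le> r" "\<delta> \<le> b - x" using r x by (auto simp: \<delta>_def)
  have slope: "s (- h) \<le> s k" if "0 < h" "0 < k" "k < \<delta>" for h k
  proof -
    have "(f (x - h) - f x) / (x - h - x) \<le> (f x - f (x + k)) / (x - (x + k))"
      using convex_on_slope_le[OF convex, of "x - h" "x + k" x] that \<delta> by force
    moreover have "(f x - f (x + k)) / (x - (x + k)) = s k"
      using that by (simp add: s_def field_simps)
    ultimately show ?thesis by (simp add: s_def)
  qed
  define D where "D = (INF k\<in>{0<..<\<delta>}. s k)"
  have bb: "bdd_below (s ` {0<..<\<delta>})"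
    using slope[of 1] by (intro bdd_belowI[of _ "s (-1)"]) auto
  have upper: "D \<le> s h" if "0 < h" "h < \<delta>" for h
    unfolding D_def using that by (intro cINF_lower[OF bb]) auto
  have lower: "s (- h) \<le> D" if "0 < h" for h
    unfolding D_def using that slope \<delta> by (intro cINF_greatest) auto
  have gap: "s h - s (- h) \<le> C * h" if "0 < h" "h < \<delta>" for h
  proof -
    have "s h - s (- h) = (f (x + h) + f (x - h) - 2 * f x) / h"
      using that by (simp add: s_def field_simps)
    also have "\<dots> \<le> C * h\<^sup>2 / h"
      using second[of h] that \<delta> by (intro divide_right_mono) auto
    finally show ?thesis using that by (simp add: power2_eq_square)
  qed
  have est: "\<bar>s h - D\<bar> \<le> C * \<bar>h\<bar>" if "h \<noteq> 0" "\<bar>h\<bar> < \<delta>" for h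
    using upper[of "\<bar>h\<bar>"] lower[of "\<bar>h\<bar>"] gap[of "\<bar>h\<bar>"] that by (cases "0 < h") auto
  have "((\<lambda>h. s h - D) \<longlongrightarrow> 0) (at 0)"
  proof (rule Lim_null_comparison)
    show "\<forall>\<^sub>F h in at 0. norm (s h - D) \<le> C * \<bar>h\<bar>"
      unfolding eventually_at using \<delta> est by (intro exI[of _ \<delta>]) auto
    show "((\<lambda>h. C * \<bar>h\<bar>) \<longlongrightarrow> 0) (at 0)"
      by (auto intro!: tendsto_eq_intros)
  qed
  then have "(s \<longlongrightarrow> D) (at 0)" by (simp add: LIM_zero_iff)
  then show ?thesis unfolding DERIV_def s_def by blast
qed

lemma exp_le_quadratic_remainder:
  fixes z :: real
  shows "exp z \<le> 1 + z + z\<^sup>2 * exp \<bar>z\<bar>"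
proof (cases "z = 0")
  case False
  obtain \<xi> where \<xi>: "\<bar>\<xi>\<bar> \<le> \<bar>z\<bar>" "exp z = (\<Sum>m<2. z ^ m / fact m) + exp \<xi> / fact 2 * z ^ 2"
    using Maclaurin_exp_le[of z 2] by blast
  have "exp \<xi> / fact 2 * z ^ 2 \<le> exp \<bar>z\<bar> * z ^ 2"
  proof (intro mult_right_mono)
    have "exp \<xi> \<le> exp \<bar>z\<bar>" using \<xi>(1) by simp
    then show "exp \<xi> / fact 2 \<le> exp \<bar>z\<bar>" using exp_gt_zero[of "\<bar>z\<bar>"] unfolding fact_2 by linarith
  qed simp
  then show ?thesis using \<xi>(2) by (simp add: numeral_2_eq_2 mult.commute)
qed simp

subsection \<open>Functions of bounded logarithmic distortion\<close>

text \<open>The inverse branch of the Gauss map for the digit \<open>Suc k\<close>; the shift lets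
  sums over the digits 1, 2, ... run over all of \<open>nat\<close>.\<close>

definition inv_branch :: "nat \<Rightarrow> real \<Rightarrow> real" where
  "inv_branch k x = 1 / (real (Suc k) + x)"

text \<open>
  The Euclidean distance is not contracted by the branch \<open>1 / (1 + x)\<close> near \<open>0\<close>; this one is
  contracted by a factor \<open>1 / 2\<close> by every branch.
\<close>

definition log_dist :: "real \<Rightarrow> real \<Rightarrow> real" where
  "log_dist x y = \<bar>ln (1 + x) - ln (1 + y)\<bar>"

text \<open>Nonnegative functions whose logarithm is \<open>B\<close>-Lipschitz for
  \<open>log_dist\<close>. The multiplicative form admits the zero function and makes closure under
  sums and nonnegative multiples immediate.\<close>

definition log_cone :: "real \<Rightarrow> (real \<Rightarrow> real) set" where
  "log_cone B = {f. \<forall>x\<in>{0..1}. 0 \<le> f x \<and> (\<forall>y\<in>{0..1}. f x \<le> exp (B * log_dist x y) * f y)}"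

lemma log_dist_nonneg: "0 \<le> log_dist x y" by (simp add: log_dist_def)

lemma log_dist_commute: "log_dist x y = log_dist y x" by (simp add: log_dist_def)

lemma log_dist_le_ln2:
  assumes "x \<in> {0..1}" "y \<in> {0..1}"
  shows "log_dist x y \<le> ln 2"
proof -
  have "0 \<le> ln (1 + x)" "ln (1 + x) \<le> ln 2" "0 \<le> ln (1 + y)" "ln (1 + y) \<le> ln 2"
    using assms by auto
  then show ?thesis unfolding log_dist_def by linarith
qed

lemma inv_branch_pos: "x \<in> {0..1} \<Longrightarrow> 0 < inv_branch k x"
  by (simp add: inv_branch_def)

lemma inv_branch_unit: "x \<in> {0..1} \<Longrightarrow> inv_branch k x \<in> {0..1}"
  by (simp add: inv_branch_def)

text \<open>For \<open>x \<le> y\<close> the ratio \<open>(c + y) / (c + x)\<close> decreases in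
  \<open>c\<close>, so \<open>c = 1\<close> is the worst case.\<close>

lemma ln_shift_diff_le:
  fixes x y :: real
  assumes "0 \<le> x" "x \<le> y"
  shows "\<bar>ln (real (Suc k) + x) - ln (real (Suc k) + y)\<bar> \<le> ln (1 + y) - ln (1 + x)"
proof -
  have "ln (real (Suc k) + y) - ln (real (Suc k) + x) = ln ((real (Suc k) + y) / (real (Suc k) + x))"
    using assms by (subst ln_div) auto
  also have "\<dots> \<le> ln ((1 + y) / (1 + x))"
  proof (intro ln_mono divide_pos_pos)
    have "(real (Suc k) + y) * (1 + x) \<le> (1 + y) * (real (Suc k) + x)"
      using mult_left_mono[of x y "real k"] assms by (simp add: algebra_simps)
    then show "(real (Suc k) + y) / (real (Suc k) + x) \<le> (1 + y) / (1 + x)"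
      using assms by (simp add: divide_simps mult.commute)
  qed (use assms in auto)
  also have "\<dots> = ln (1 + y) - ln (1 + x)" using assms by (subst ln_div) auto
  finally have "ln (real (Suc k) + y) - ln (real (Suc k) + x) \<le> ln (1 + y) - ln (1 + x)" .
  moreover have "ln (real (Suc k) + x) \<le> ln (real (Suc k) + y)" using assms by simp
  ultimately show ?thesis by linarith
qed

lemma ln_inv_branch_diff_le:
  assumes "x \<in> {0..1}" "y \<in> {0..1}"
  shows "\<bar>ln (inv_branch k x) - ln (inv_branch k y)\<bar> \<le> log_dist x y"
  using ln_shift_diff_le[of x y k] ln_shift_diff_le[of y x k] assms
  by (cases "x \<le> y") (auto simp: inv_branch_def ln_div log_dist_def)

text \<open>Infinitesimally the contraction factor at \<open>z\<close> is
  \<open>(1 + z) / ((c + z) * (c + z + 1))\<close> with \<open>c = Suc k\<close>, which is at most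
  \<open>1 / 2\<close>. Instead of integrating this, the proof doubles the left side and
  exponentiates, which leaves a polynomial inequality.\<close>

lemma log_dist_inv_branch_le:
  assumes "x \<in> {0..1}" "y \<in> {0..1}"
  shows "log_dist (inv_branch k x) (inv_branch k y) \<le> log_dist x y / 2"
proof -
  have main: "log_dist (inv_branch k x) (inv_branch k y) \<le> (ln (1 + y) - ln (1 + x)) / 2"
    if xy: "0 \<le> x" "x \<le> y" for x y
  proof -
    define c where "c = real (Suc k)"
    have c: "1 \<le> c" by (simp add: c_def)
    have L: "ln (1 + inv_branch k z) = ln (c + z + 1) - ln (c + z)" if "0 \<le> z" for z
    proof -
      have "1 + inv_branch k z = (c + z + 1) / (c + z)" using that c by (simp add: inv_branch_def c_def field_simps)
      then show ?thesis using that c by (simp add: ln_div)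
    qed
    have antimono: "ln (1 + inv_branch k y) \<le> ln (1 + inv_branch k x)"
      using xy by (simp add: inv_branch_def frac_le add_pos_nonneg)
    have "2 * (ln (1 + inv_branch k x) - ln (1 + inv_branch k y)) =
        ln (((c + x + 1) * (c + y) / ((c + x) * (c + y + 1)))\<^sup>2)"
    proof -
      have "c + x \<noteq> 0" "c + y \<noteq> 0" "c + x + 1 \<noteq> 0" "c + y + 1 \<noteq> 0" using xy c by linarith+
      then show ?thesis
        using xy c by (subst ln_realpow) (simp_all add: L ln_div ln_mult)
    qed
    also have "\<dots> \<le> ln ((1 + y) / (1 + x))"
    proof (intro ln_mono)
      have *: "(c + y)\<^sup>2 * (1 + x) * (c + x + 1)\<^sup>2 \<le> (1 + y) * (c + x)\<^sup>2 * (c + y + 1)\<^sup>2"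
      proof -
        \<comment> \<open>In these variables \<open>1 + x = u - e\<close> and
          \<open>1 + y = v - e\<close>, and the difference of the two sides is \<open>v - u\<close>
          times a nonnegative factor.\<close>
        define u v e where "u = c + x" and "v = c + y" and "e = c - 1"
        have uv: "1 \<le> u" "u \<le> v" "0 \<le> e" "e \<le> u - 1" using c xy by (auto simp: u_def v_def e_def)
        have "v\<^sup>2 * (u - e) * (u + 1)\<^sup>2 \<le> (v - e) * u\<^sup>2 * (v + 1)\<^sup>2"
        proof -
          have "(v - e) * u\<^sup>2 * (v + 1)\<^sup>2 - v\<^sup>2 * (u - e) * (u + 1)\<^sup>2 =
            (v - u) * (u * v * (u * v - 1) + e * (u * (v + 1) + v * (u + 1)))"
            by algebra
          moreover have "1 \<le> u * v" using uv mult_mono[of 1 u 1 v] by auto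
          ultimately show ?thesis using uv
            by (smt (verit) mult_nonneg_nonneg)
        qed
        then show ?thesis by (simp add: u_def v_def e_def algebra_simps)
      qed
      have "((c + x + 1) * (c + y) / ((c + x) * (c + y + 1)))\<^sup>2 =
          ((c + y)\<^sup>2 * (c + x + 1)\<^sup>2) / ((c + x)\<^sup>2 * (c + y + 1)\<^sup>2)"
        by (simp add: power_divide power_mult_distrib mult.commute)
      also have "\<dots> \<le> (1 + y) / (1 + x)"
        using * xy c by (simp add: divide_simps mult_ac)
      finally show "((c + x + 1) * (c + y) / ((c + x) * (c + y + 1)))\<^sup>2 \<le> (1 + y) / (1 + x)" .
    qed (use xy c in auto)
    also have "\<dots> = ln (1 + y) - ln (1 + x)" using xy by (subst ln_div) auto
    finally have "ln (1 + inv_branch k x) - ln (1 + inv_branch k y) \<le> (ln (1 + y) - ln (1 + x)) / 2"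
      by (simp add: field_simps)
    moreover have "log_dist (inv_branch k x) (inv_branch k y) = ln (1 + inv_branch k x) - ln (1 + inv_branch k y)"
      unfolding log_dist_def using antimono by (intro abs_of_nonneg) (simp only: diff_ge_0_iff_ge)
    ultimately show ?thesis by (simp only:)
  qed
  show ?thesis
  proof (cases "x \<le> y")
    case True
    then show ?thesis using main[of x y] assms unfolding log_dist_def by auto
  next
    case False
    then show ?thesis using main[of y x] assms by (simp add: log_dist_commute[of "inv_branch k x"] ) (simp add: log_dist_def)
  qed
qed

section \<open>Closure properties of the cone, a Harnack inequality and absorption\<close>

lemma log_cone_nonneg: "f \<in> log_cone B \<Longrightarrow> x \<in> {0..1} \<Longrightarrow> 0 \<le> f x"
  by (simp add: log_cone_def)

lemma log_coneD: "f \<in> log_cone B \<Longrightarrow> x \<in> {0..1} \<Longrightarrow> y \<in> {0..1} \<Longrightarrow> f x \<le> exp (B * log_dist x y) * f y"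
  by (simp add: log_cone_def)

lemma log_cone_add: "f \<in> log_cone B \<Longrightarrow> g \<in> log_cone B \<Longrightarrow> (\<lambda>x. f x + g x) \<in> log_cone B"
  unfolding log_cone_def by (auto simp: distrib_left intro!: add_mono)

lemma log_cone_scale: "f \<in> log_cone B \<Longrightarrow> 0 \<le> a \<Longrightarrow> (\<lambda>x. a * f x) \<in> log_cone B"
  unfolding log_cone_def by (auto simp: mult.left_commute intro!: mult_left_mono)

lemma log_cone_cong: "f \<in> log_cone B \<Longrightarrow> (\<And>x. x \<in> {0..1} \<Longrightarrow> g x = f x) \<Longrightarrow> g \<in> log_cone B"
  unfolding log_cone_def by auto

lemma log_cone_mono: 
  assumes "f \<in> log_cone B" "B \<le> B'"
  shows "f \<in> log_cone B'"
proof -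
  have "f x \<le> exp (B' * log_dist x y) * f y" if "x \<in> {0..1}" "y \<in> {0..1}" for x y
  proof -
    have "f x \<le> exp (B * log_dist x y) * f y" using assms that by (simp add: log_cone_def)
    also have "\<dots> \<le> exp (B' * log_dist x y) * f y"
      using assms that log_dist_nonneg by (intro mult_right_mono) (auto simp: log_cone_def intro: mult_right_mono)
    finally show ?thesis .
  qed
  then show ?thesis using assms by (simp add: log_cone_def)
qed

lemma log_cone_const: "0 \<le> a \<Longrightarrow> 0 \<le> B \<Longrightarrow> (\<lambda>_. a) \<in> log_cone B"
  unfolding log_cone_def using log_dist_nonneg by (auto simp: mult_le_cancel_right1)

text \<open>A Harnack inequality: the unit interval has \<open>log_dist\<close> diameter at most
  \<open>ln 2\<close>, and \<open>exp (B * ln 2) = 2 powr B\<close>.\<close>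

lemma log_cone_le:
  assumes "f \<in> log_cone B" "0 \<le> B" "x \<in> {0..1}" "y \<in> {0..1}"
  shows "f x \<le> 2 powr B * f y"
proof -
  have "f x \<le> exp (B * log_dist x y) * f y" using assms by (simp add: log_cone_def)
  also have "\<dots> \<le> 2 powr B * f y"
    using assms log_dist_le_ln2[of x y] unfolding powr_def
    by (intro mult_right_mono) (auto simp: log_cone_def intro: mult_left_mono)
  finally show ?thesis .
qed

text \<open>The constant of \<open>log_cone_absorb\<close>. It is the product of
  \<open>(2 * B + 1) * 2 powr (B + 1)\<close>, the price for the distortion of the subtracted
  function, and \<open>2 powr (2 * B)\<close>, two applications of the Harnack inequality.\<close>

definition absorb :: "real \<Rightarrow> real" where
  "absorb B = (2 * B + 1) * 2 powr (3 * B + 1)"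

lemma absorb_ge: "0 \<le> B \<Longrightarrow> 2 powr (2 * B) \<le> absorb B"
  unfolding absorb_def
  using mult_mono[of 1 "2 * B + 1" "2 powr (2 * B)" "2 powr (3 * B + 1)"] by simp

lemma absorb_ge_1: "0 \<le> B \<Longrightarrow> 1 \<le> absorb B"
  using absorb_ge[of B] ge_one_powr_ge_zero[of 2 "2 * B"] by linarith

text \<open>A quantitative form of the finite Birkhoff diameter of \<open>log_cone B\<close> inside
  \<open>log_cone (B + 1)\<close>: domination at the single point \<open>0\<close> suffices for
  subtracting \<open>f\<close> from a fixed multiple of \<open>g\<close>. Subtracting costs a term
  of order \<open>d = log_dist x y\<close>; enlarging the exponent from \<open>B\<close> to
  \<open>B + 1\<close> gains \<open>d * g y\<close>, and the factor \<open>absorb B\<close> makes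
  the gain outweigh the cost.\<close>

lemma log_cone_absorb:
  assumes f: "f \<in> log_cone B" and g: "g \<in> log_cone B" and B: "0 \<le> B" and 0: "f 0 \<le> g 0"
  shows "(\<lambda>x. absorb B * g x - f x) \<in> log_cone (B + 1)"
proof -
  have fg: "f x \<le> 2 powr (2 * B) * g x" if "x \<in> {0..1}" for x
  proof -
    have "f x \<le> 2 powr B * f 0" using log_cone_le[OF f B that, of 0] by simp
    also have "\<dots> \<le> 2 powr B * (2 powr B * g x)"
      using 0 log_cone_le[OF g B _ that, of 0] by (intro mult_left_mono) auto
    also have "\<dots> = 2 powr (2 * B) * g x" by (simp add: powr_add[symmetric])
    finally show ?thesis .
  qed
  have "0 \<le> absorb B * g x - f x" if "x \<in> {0..1}" for x
    using fg[OF that] mult_right_mono[OF absorb_ge[OF B] log_cone_nonneg[OF g that]] by linarith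
  moreover have "absorb B * g x - f x \<le> exp ((B + 1) * log_dist x y) * (absorb B * g y - f y)"
    if x: "x \<in> {0..1}" and y: "y \<in> {0..1}" for x y
  proof -
    define d where "d = log_dist x y"
    have d: "0 \<le> d" "d \<le> ln 2" using log_dist_nonneg log_dist_le_ln2[OF x y] by (auto simp: d_def)
    have gy: "0 \<le> g y" and fy: "0 \<le> f y" using log_cone_nonneg f g y by auto
    \<comment> \<open>The gain from the larger exponent, at least linear in
      \<open>d\<close>.\<close>
    have "d * g y \<le> (exp ((B + 1) * d) - exp (B * d)) * g y"
    proof (intro mult_right_mono gy)
      have "1 * d \<le> exp (B * d) * (exp d - 1)"
      proof (intro mult_mono)
        show "d \<le> exp d - 1" using exp_ge_add_one_self[of d] by linarith
      qed (use d B in auto)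
      then show "d \<le> exp ((B + 1) * d) - exp (B * d)"
        by (simp add: algebra_simps exp_add)
    qed
    then have G: "absorb B * (d * g y) \<le> absorb B * (exp ((B + 1) * d) * g y - g x)"
      using log_coneD[OF g x y] absorb_ge_1[OF B]
      by (intro mult_left_mono) (auto simp: d_def algebra_simps)
    have "f y \<le> exp (B * d) * f x" using log_coneD[OF f y x] by (simp add: d_def log_dist_commute)
    then have "exp (- (B * d)) * f y \<le> f x" by (simp add: exp_minus field_simps)
    \<comment> \<open>The cost of subtracting \<open>f\<close>, shown below to be at most linear in
      \<open>d\<close> and comparable to \<open>g y\<close>.\<close>
    then have "exp ((B + 1) * d) * f y - f x \<le> (exp ((B + 1) * d) - exp (- (B * d))) * f y"
      by (simp add: algebra_simps)
    also have "\<dots> \<le> ((2 * B + 1) * d * 2 powr (B + 1)) * (2 powr (2 * B) * g y)"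
    proof (intro mult_mono fg y fy)
      have "exp ((B + 1) * d) - exp (- (B * d)) = exp ((B + 1) * d) * (1 - exp (- ((2 * B + 1) * d)))"
        by (simp add: algebra_simps flip: exp_add)
      also have "\<dots> \<le> 2 powr (B + 1) * ((2 * B + 1) * d)"
        using d B exp_ge_add_one_self[of "- ((2 * B + 1) * d)"]
        by (intro mult_mono) (auto simp: powr_def intro!: mult_left_mono)
      finally show "exp ((B + 1) * d) - exp (- (B * d)) \<le> (2 * B + 1) * d * 2 powr (B + 1)"
        by (simp add: mult_ac)
    qed (use d B in auto)
    also have "\<dots> = absorb B * (d * g y)"
      by (simp add: absorb_def mult_ac flip: powr_add)
    finally show ?thesis using G by (simp add: d_def algebra_simps)
  qed
  ultimately show ?thesis by (simp add: log_cone_def)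
qed

subsection \<open>Transfer operators of the Gauss map\<close>

text \<open>The weight sequence \<open>c\<close> is left free so that the operators for
  \<open>q\<close>, for nearby exponents and for the derivative in \<open>q\<close> are all
  instances.\<close>

definition ruelle :: "real \<Rightarrow> (nat \<Rightarrow> real) \<Rightarrow> (real \<Rightarrow> real) \<Rightarrow> real \<Rightarrow> real" where
  "ruelle t c f x = (\<Sum>k. c k * inv_branch k x powr (2 * t) * f (inv_branch k x))"

text \<open>Since \<open>inv_branch k x\<close> is comparable to \<open>1 / Suc k\<close> uniformly
  in \<open>x\<close>, this makes the series in \<open>ruelle\<close> converge for every bounded
  \<open>f\<close>.\<close>

definition admissible :: "real \<Rightarrow> (nat \<Rightarrow> real) \<Rightarrow> bool" where
  "admissible t c \<longleftrightarrow> (\<forall>k. 0 \<le> c k) \<and> summable (\<lambda>k. c k * real (Suc k) powr (- 2 * t))"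

definition bounded_unit :: "(real \<Rightarrow> real) \<Rightarrow> bool" where
  "bounded_unit f \<longleftrightarrow> (\<exists>M. \<forall>x\<in>{0..1}. \<bar>f x\<bar> \<le> M)"

lemma bounded_unitI: "(\<And>x. x \<in> {0..1} \<Longrightarrow> \<bar>f x\<bar> \<le> M) \<Longrightarrow> bounded_unit f"
  unfolding bounded_unit_def by blast

lemma bounded_unit_const [simp]: "bounded_unit (\<lambda>_. a)"
  by (rule bounded_unitI[of _ "\<bar>a\<bar>"]) simp

lemma bounded_unit_add [intro]:
  assumes "bounded_unit f" "bounded_unit g"
  shows "bounded_unit (\<lambda>x. f x + g x)"
proof -
  obtain M N where "\<And>x. x \<in> {0..1} \<Longrightarrow> \<bar>f x\<bar> \<le> M" "\<And>x. x \<in> {0..1} \<Longrightarrow> \<bar>g x\<bar> \<le> N"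
    using assms unfolding bounded_unit_def by blast
  then show ?thesis
    by (intro bounded_unitI[of _ "M + N"] order.trans[OF abs_triangle_ineq] add_mono)
qed

lemma bounded_unit_scale [intro]:
  assumes "bounded_unit f"
  shows "bounded_unit (\<lambda>x. a * f x)"
proof -
  obtain M where "\<And>x. x \<in> {0..1} \<Longrightarrow> \<bar>f x\<bar> \<le> M"
    using assms unfolding bounded_unit_def by blast
  then show ?thesis
    unfolding bounded_unit_def abs_mult by (intro exI[of _ "\<bar>a\<bar> * M"] ballI mult_left_mono) auto
qed

lemma log_cone_bounded_unit:
  assumes "f \<in> log_cone B" "0 \<le> B"
  shows "bounded_unit f"
proof (rule bounded_unitI)
  fix x :: real assume x: "x \<in> {0..1}"
  show "\<bar>f x\<bar> \<le> 2 powr B * f 0"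
    using log_cone_le[OF assms x, of 0] log_cone_nonneg[OF assms(1) x] by simp
qed

text \<open>The ratio \<open>r\<close> of \<open>inv_branch k x\<close> to \<open>1 / Suc k\<close>
  lies in \<open>[1/2, 1]\<close>, and \<open>(1 / 2) powr (2 * t) = 4 powr (- t)\<close>. The
  minimum and maximum cover both signs of \<open>t\<close>, as the power is increasing or decreasing
  in \<open>r\<close> accordingly.\<close>

lemma inv_branch_powr_bounds:
  assumes "x \<in> {0..1}"
  shows "min 1 (4 powr (- t)) * real (Suc k) powr (- 2 * t) \<le> inv_branch k x powr (2 * t)"
    and "inv_branch k x powr (2 * t) \<le> max 1 (4 powr (- t)) * real (Suc k) powr (- 2 * t)"
proof -
  define r where "r = real (Suc k) * inv_branch k x"
  have r: "1 / 2 \<le> r" "r \<le> 1" using assms by (auto simp: r_def inv_branch_def field_simps)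
  have "inv_branch k x = r * (1 / real (Suc k))" by (simp add: r_def)
  then have "inv_branch k x powr (2 * t) = r powr (2 * t) * (1 / real (Suc k)) powr (2 * t)"
    using r by (simp only: powr_mult)
  also have "(1 / real (Suc k)) powr (2 * t) = real (Suc k) powr (- 2 * t)"
    by (simp add: powr_divide powr_minus_divide)
  finally have eq: "inv_branch k x powr (2 * t) = r powr (2 * t) * real (Suc k) powr (- 2 * t)" .
  have four: "4 powr (- t) = (1 / 2) powr (2 * t)"
  proof -
    have "(1 / 2) powr (2 * t) = ((1 / 2) powr 2) powr t" by (simp only: powr_powr)
    also have "\<dots> = (1 / 4) powr t" by (simp add: power_divide)
    finally show ?thesis by (simp add: powr_divide powr_minus_divide)
  qed
  have "min 1 (4 powr (- t)) \<le> r powr (2 * t) \<and> r powr (2 * t) \<le> max 1 (4 powr (- t))"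
  proof (cases "0 \<le> t")
    case True
    then have "(1 / 2) powr (2 * t) \<le> r powr (2 * t)" "r powr (2 * t) \<le> 1 powr (2 * t)"
      using r by (intro powr_mono2; simp)+
    then show ?thesis unfolding four by auto
  next
    case False
    then have "r powr (2 * t) \<le> (1 / 2) powr (2 * t)" "1 powr (2 * t) \<le> r powr (2 * t)"
      using r by (intro powr_mono2'; simp)+
    then show ?thesis unfolding four by auto
  qed
  then show "min 1 (4 powr (- t)) * real (Suc k) powr (- 2 * t) \<le> inv_branch k x powr (2 * t)"
    and "inv_branch k x powr (2 * t) \<le> max 1 (4 powr (- t)) * real (Suc k) powr (- 2 * t)"
    unfolding eq by (auto intro: mult_right_mono)
qed

context
  fixes t :: real and c :: "nat \<Rightarrow> real"
  assumes adm: "admissible t c"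
begin

lemma ruelle_summable:
  assumes f: "bounded_unit f" and x: "x \<in> {0..1}"
  shows "summable (\<lambda>k. c k * inv_branch k x powr (2 * t) * f (inv_branch k x))"
proof -
  obtain M where M: "\<And>x. x \<in> {0..1} \<Longrightarrow> \<bar>f x\<bar> \<le> M"
    using f unfolding bounded_unit_def by blast
  have "0 \<le> M" using M[of 0] by auto
  show ?thesis
  proof (rule summable_comparison_test')
    show "summable (\<lambda>k. M * (max 1 (4 powr (- t)) * (c k * real (Suc k) powr (- 2 * t))))"
      using adm by (intro summable_mult) (simp add: admissible_def)
    show "norm (c k * inv_branch k x powr (2 * t) * f (inv_branch k x))
      \<le> M * (max 1 (4 powr (- t)) * (c k * real (Suc k) powr (- 2 * t)))" if "0 \<le> k" for k
    proof -
      have c: "0 \<le> c k" using adm by (simp add: admissible_def)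
      have "norm (c k * inv_branch k x powr (2 * t) * f (inv_branch k x)) = c k * (inv_branch k x powr (2 * t)) * \<bar>f (inv_branch k x)\<bar>"
        using c by (simp add: abs_mult)
      also have "\<dots> \<le> c k * (max 1 (4 powr (- t)) * real (Suc k) powr (- 2 * t)) * M"
        using c M inv_branch_unit[OF x] inv_branch_powr_bounds(2)[OF x]
        by (intro mult_mono mult_nonneg_nonneg) auto
      finally show ?thesis by (simp only: mult_ac)
    qed
  qed
qed

lemma ruelle_add:
  assumes "bounded_unit f" "bounded_unit g" "x \<in> {0..1}"
  shows "ruelle t c (\<lambda>y. f y + g y) x = ruelle t c f x + ruelle t c g x"
  unfolding ruelle_def distrib_left
  by (rule suminf_add[symmetric]) (intro ruelle_summable assms)+

lemma ruelle_scale: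
  assumes "bounded_unit f" "x \<in> {0..1}"
  shows "ruelle t c (\<lambda>y. a * f y) x = a * ruelle t c f x"
proof -
  have "ruelle t c (\<lambda>y. a * f y) x = (\<Sum>k. a * (c k * inv_branch k x powr (2 * t) * f (inv_branch k x)))"
    by (simp add: ruelle_def mult_ac)
  then show ?thesis
    using suminf_mult[OF ruelle_summable[OF assms]] by (simp add: ruelle_def)
qed

lemma ruelle_mono:
  assumes "bounded_unit f" "bounded_unit g" "x \<in> {0..1}"
    and "\<And>y. y \<in> {0..1} \<Longrightarrow> f y \<le> g y"
  shows "ruelle t c f x \<le> ruelle t c g x"
  unfolding ruelle_def
proof (rule suminf_le)
  show "c k * inv_branch k x powr (2 * t) * f (inv_branch k x) \<le> c k * inv_branch k x powr (2 * t) * g (inv_branch k x)" for k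
    using assms(4)[OF inv_branch_unit[OF assms(3)]] adm by (intro mult_left_mono) (auto simp: admissible_def)
qed (intro ruelle_summable assms)+

lemma ruelle_nonneg:
  assumes "bounded_unit f" "x \<in> {0..1}" "\<And>y. y \<in> {0..1} \<Longrightarrow> 0 \<le> f y"
  shows "0 \<le> ruelle t c f x"
  unfolding ruelle_def
proof (rule suminf_nonneg)
  show "0 \<le> c k * inv_branch k x powr (2 * t) * f (inv_branch k x)" for k
    using assms(3)[OF inv_branch_unit[OF assms(2)]] adm by (intro mult_nonneg_nonneg) (auto simp: admissible_def)
qed (intro ruelle_summable assms)

end

lemma admissible_scale: "admissible t c \<Longrightarrow> 0 \<le> a \<Longrightarrow> admissible t (\<lambda>k. a * c k)"
  unfolding admissible_def mult.assoc by (intro conjI allI summable_mult) auto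

lemma admissible_mono:
  assumes "admissible t d" "\<And>k. 0 \<le> c k" "\<And>k. c k \<le> d k"
  shows "admissible t c"
proof -
  have "summable (\<lambda>k. c k * real (Suc k) powr (- 2 * t))"
  proof (rule summable_comparison_test')
    show "summable (\<lambda>k. d k * real (Suc k) powr (- 2 * t))"
      using assms(1) by (simp add: admissible_def)
    show "norm (c k * real (Suc k) powr (- 2 * t)) \<le> d k * real (Suc k) powr (- 2 * t)" if "0 \<le> k" for k
      using mult_right_mono[OF assms(3)[of k], of "real (Suc k) powr (- 2 * t)"] assms(2)[of k]
      by (simp add: abs_mult)
  qed
  then show ?thesis using assms(2) by (simp add: admissible_def)
qed

text \<open>Three weights, with coefficients of arbitrary sign, because this transports the
  second-order expansion \<open>pow_weight_perturb_le\<close> from weights to operators.\<close>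

lemma ruelle_weight_le:
  assumes adm: "admissible t c" "admissible t c1" "admissible t c2" "admissible t c3"
    and f: "bounded_unit f" "x \<in> {0..1}" "\<And>y. y \<in> {0..1} \<Longrightarrow> 0 \<le> f y"
    and le: "\<And>k. c k \<le> c1 k + a * c2 k + b * c3 k"
  shows "ruelle t c f x \<le> ruelle t c1 f x + a * ruelle t c2 f x + b * ruelle t c3 f x"
proof -
  define g where "g d k = d k * inv_branch k x powr (2 * t) * f (inv_branch k x)" for d :: "nat \<Rightarrow> real" and k
  have s: "summable (g d)" if "admissible t d" for d
    unfolding g_def using ruelle_summable[OF that f(1,2)] .
  have r: "g d sums ruelle t d f x" if "admissible t d" for d
    using summable_sums[OF s[OF that]] unfolding ruelle_def g_def .
  have "(\<lambda>k. g c1 k + a * g c2 k + b * g c3 k) sums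
      (ruelle t c1 f x + a * ruelle t c2 f x + b * ruelle t c3 f x)"
    using adm by (intro sums_add sums_mult r)
  then show ?thesis
  proof (rule sums_le[OF _ r[OF adm(1)], rotated])
    fix k
    have "c k * (inv_branch k x powr (2 * t) * f (inv_branch k x)) \<le> (c1 k + a * c2 k + b * c3 k) * (inv_branch k x powr (2 * t) * f (inv_branch k x))"
      using f(3)[OF inv_branch_unit[OF f(2)]] by (intro mult_right_mono le mult_nonneg_nonneg) auto
    then show "g c k \<le> g c1 k + a * g c2 k + b * g c3 k"
      by (simp add: g_def algebra_simps)
  qed
qed

text \<open>Composition with a branch halves the exponent by the contraction of
  \<open>log_dist\<close>; the factor \<open>inv_branch k x powr (2 * t)\<close> adds
  \<open>2 * |t|\<close> since \<open>ln (inv_branch k x)\<close> is 1-Lipschitz. The resulting map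
  \<open>B / 2 + 2 * |t|\<close> has fixed point \<open>4 * |t|\<close> and strictly lowers every
  larger \<open>B\<close>.\<close>

lemma log_cone_branch:
  assumes f: "f \<in> log_cone B" and B: "0 \<le> B"
  shows "(\<lambda>x. inv_branch k x powr (2 * t) * f (inv_branch k x)) \<in> log_cone (B / 2 + 2 * \<bar>t\<bar>)"
proof -
  have "inv_branch k x powr (2 * t) * f (inv_branch k x)
      \<le> exp ((B / 2 + 2 * \<bar>t\<bar>) * log_dist x y) * (inv_branch k y powr (2 * t) * f (inv_branch k y))"
    if x: "x \<in> {0..1}" and y: "y \<in> {0..1}" for x y
  proof -
    have "2 * t * (ln (inv_branch k x) - ln (inv_branch k y)) \<le> 2 * \<bar>t\<bar> * \<bar>ln (inv_branch k x) - ln (inv_branch k y)\<bar>"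
      by (metis abs_ge_self abs_mult abs_numeral)
    also have "\<dots> \<le> 2 * \<bar>t\<bar> * log_dist x y"
      using ln_inv_branch_diff_le[OF x y] by (intro mult_left_mono) auto
    finally have "inv_branch k x powr (2 * t) \<le> exp (2 * \<bar>t\<bar> * log_dist x y) * inv_branch k y powr (2 * t)"
      using inv_branch_pos[OF x, of k] inv_branch_pos[OF y, of k] by (simp add: powr_def right_diff_distrib flip: exp_add)
    moreover have "f (inv_branch k x) \<le> exp (B / 2 * log_dist x y) * f (inv_branch k y)"
    proof -
      have "f (inv_branch k x) \<le> exp (B * log_dist (inv_branch k x) (inv_branch k y)) * f (inv_branch k y)"
        using log_coneD[OF f] inv_branch_unit x y by blast
      also have "\<dots> \<le> exp (B / 2 * log_dist x y) * f (inv_branch k y)"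
        using mult_left_mono[OF log_dist_inv_branch_le[OF x y] B] log_cone_nonneg[OF f inv_branch_unit[OF y]]
        by (intro mult_right_mono) auto
      finally show ?thesis .
    qed
    ultimately have "inv_branch k x powr (2 * t) * f (inv_branch k x) \<le>
       (exp (2 * \<bar>t\<bar> * log_dist x y) * inv_branch k y powr (2 * t)) * (exp (B / 2 * log_dist x y) * f (inv_branch k y))"
      using log_cone_nonneg[OF f inv_branch_unit[OF x]] by (intro mult_mono) auto
    also have "\<dots> = exp ((B / 2 + 2 * \<bar>t\<bar>) * log_dist x y) * (inv_branch k y powr (2 * t) * f (inv_branch k y))"
      by (simp add: distrib_right exp_add)
    finally show ?thesis .
  qed
  moreover have "0 \<le> inv_branch k x powr (2 * t) * f (inv_branch k x)" if "x \<in> {0..1}" for x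
    using log_cone_nonneg[OF f inv_branch_unit[OF that]] by simp
  ultimately show ?thesis unfolding log_cone_def by blast
qed

lemma log_cone_ruelle:
  assumes adm: "admissible t c" and f: "f \<in> log_cone B" and B: "0 \<le> B"
  shows "ruelle t c f \<in> log_cone (B / 2 + 2 * \<bar>t\<bar>)"
proof -
  define g where "g k x = inv_branch k x powr (2 * t) * f (inv_branch k x)" for k x
  have g: "g k \<in> log_cone (B / 2 + 2 * \<bar>t\<bar>)" for k
    unfolding g_def by (rule log_cone_branch[OF f B])
  have bf: "bounded_unit f" using log_cone_bounded_unit[OF f B] .
  have s: "summable (\<lambda>k. c k * g k x)" if "x \<in> {0..1}" for x
    using ruelle_summable[OF adm bf that] by (simp add: g_def mult.assoc)
  have r: "ruelle t c f x = (\<Sum>k. c k * g k x)" for x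
    by (simp add: ruelle_def g_def mult.assoc)
  have "ruelle t c f x \<le> exp ((B / 2 + 2 * \<bar>t\<bar>) * log_dist x y) * ruelle t c f y"
    if x: "x \<in> {0..1}" and y: "y \<in> {0..1}" for x y
  proof (rule sums_le)
    show "(\<lambda>k. c k * g k x) sums ruelle t c f x"
      unfolding r using s[OF x] by (rule summable_sums)
    show "(\<lambda>k. exp ((B / 2 + 2 * \<bar>t\<bar>) * log_dist x y) * (c k * g k y)) sums
        (exp ((B / 2 + 2 * \<bar>t\<bar>) * log_dist x y) * ruelle t c f y)"
      unfolding r using s[OF y] by (intro sums_mult summable_sums)
    show "c k * g k x \<le> exp ((B / 2 + 2 * \<bar>t\<bar>) * log_dist x y) * (c k * g k y)" for k
      using mult_left_mono[OF log_coneD[OF g x y], of "c k" k] adm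
      by (simp add: admissible_def mult.left_commute)
  qed
  moreover have "0 \<le> ruelle t c f x" if "x \<in> {0..1}" for x
    using ruelle_nonneg[OF adm bf that] log_cone_nonneg[OF f] by blast
  ultimately show ?thesis unfolding log_cone_def by blast
qed

subsection \<open>Iterates of the transfer operator and the pressure\<close>

definition pow_weight :: "real \<Rightarrow> nat \<Rightarrow> real" where
  "pow_weight q k = real (Suc k) powr q"

definition iterate :: "real \<Rightarrow> real \<Rightarrow> nat \<Rightarrow> real \<Rightarrow> real" where
  "iterate t q n = (ruelle t (pow_weight q) ^^ n) (\<lambda>_. 1)"

lemma iterate_0 [simp]: "iterate t q 0 = (\<lambda>_. 1)"
  by (simp add: iterate_def)

lemma iterate_Suc [simp]: "iterate t q (Suc n) = ruelle t (pow_weight q) (iterate t q n)"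
  by (simp add: iterate_def)

lemma zeta_summable:
  assumes "1 < s"
  shows "summable (\<lambda>n. real (Suc n) powr (- s))"
proof -
  have "summable (\<lambda>n. real n powr (- s))" using assms by (simp add: summable_real_powr_iff)
  then show ?thesis by (subst summable_Suc_iff)
qed

lemma zeta_ge_1: "1 < s \<Longrightarrow> 1 \<le> zeta s"
  unfolding zeta_def
  using sum_le_suminf[OF zeta_summable, of s "{0}"] by simp

lemma pow_weight_admissible:
  assumes "1 < 2 * t - q"
  shows "admissible t (pow_weight q)"
proof -
  have "(\<lambda>k. pow_weight q k * real (Suc k) powr (- 2 * t)) = (\<lambda>k. real (Suc k) powr (- (2 * t - q)))"
    by (auto simp: pow_weight_def fun_eq_iff simp flip: powr_add)
  then show ?thesis
    using zeta_summable[OF assms] by (simp add: admissible_def pow_weight_def)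
qed

lemma ruelle_pow_weight_one_bounds:
  assumes D: "1 < 2 * t - q" and x: "x \<in> {0..1}"
  shows "min 1 (4 powr (- t)) * zeta (2 * t - q) \<le> ruelle t (pow_weight q) (\<lambda>_. 1) x"
    and "ruelle t (pow_weight q) (\<lambda>_. 1) x \<le> max 1 (4 powr (- t)) * zeta (2 * t - q)"
proof -
  have z: "(\<lambda>k. a * (pow_weight q k * real (Suc k) powr (- 2 * t))) sums (a * zeta (2 * t - q))" for a
  proof -
    have "(\<lambda>k. pow_weight q k * real (Suc k) powr (- 2 * t)) = (\<lambda>k. real (Suc k) powr (- (2 * t - q)))"
      by (auto simp: pow_weight_def fun_eq_iff simp flip: powr_add)
    then show ?thesis
      using summable_sums[OF zeta_summable[OF D]] by (intro sums_mult) (simp add: zeta_def)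
  qed
  have r: "(\<lambda>k. pow_weight q k * inv_branch k x powr (2 * t)) sums ruelle t (pow_weight q) (\<lambda>_. 1) x"
    using summable_sums[OF ruelle_summable[OF pow_weight_admissible[OF D] bounded_unit_const[of 1] x]]
    by (simp add: ruelle_def)
  have p: "0 \<le> pow_weight q k" for k by (simp add: pow_weight_def)
  show "min 1 (4 powr (- t)) * zeta (2 * t - q) \<le> ruelle t (pow_weight q) (\<lambda>_. 1) x"
    using mult_left_mono[OF inv_branch_powr_bounds(1)[OF x] p]
    by (intro sums_le[OF _ z r]) (simp only: mult.left_commute)
  show "ruelle t (pow_weight q) (\<lambda>_. 1) x \<le> max 1 (4 powr (- t)) * zeta (2 * t - q)"
    using mult_left_mono[OF inv_branch_powr_bounds(2)[OF x] p]
    by (intro sums_le[OF _ r z]) (simp only: mult.left_commute)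
qed

text \<open>The exponent \<open>4 * |t|\<close> is the fixed point of the map in
  \<open>log_cone_ruelle\<close>, so the distortion bound is uniform in \<open>n\<close>.\<close>

lemma iterate_cone:
  assumes D: "1 < 2 * t - q"
  shows "iterate t q n \<in> log_cone (4 * \<bar>t\<bar>)"
proof (induction n)
  case 0
  then show ?case by (simp add: log_cone_const)
next
  case (Suc n)
  have "ruelle t (pow_weight q) (iterate t q n) \<in> log_cone (4 * \<bar>t\<bar> / 2 + 2 * \<bar>t\<bar>)"
    using Suc by (intro log_cone_ruelle pow_weight_admissible[OF D]) auto
  then show ?case by simp
qed

lemma iterate_bounded:
  assumes D: "1 < 2 * t - q"
  shows "bounded_unit (iterate t q n)"
  using log_cone_bounded_unit[OF iterate_cone[OF D]] by simp

lemma iterate_bounds: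
  assumes D: "1 < 2 * t - q" and x: "x \<in> {0..1}"
  shows "(min 1 (4 powr (- t)) * zeta (2 * t - q)) ^ n \<le> iterate t q n x"
    and "iterate t q n x \<le> (max 1 (4 powr (- t)) * zeta (2 * t - q)) ^ n"
proof -
  define l u where "l = min 1 (4 powr (- t)) * zeta (2 * t - q)"
    and "u = max 1 (4 powr (- t)) * zeta (2 * t - q)"
  have l: "0 \<le> l" and u: "0 \<le> u" using zeta_ge_1[OF D] by (auto simp: l_def u_def)
  note adm = pow_weight_admissible[OF D]
  have "\<forall>x\<in>{0..1}. l ^ n \<le> iterate t q n x \<and> iterate t q n x \<le> u ^ n"
  proof (induction n)
    case (Suc n)
    show ?case
    proof
      fix x :: real assume x: "x \<in> {0..1}"
      have "l ^ Suc n \<le> l ^ n * ruelle t (pow_weight q) (\<lambda>_. 1) x"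
        unfolding power_Suc2 using ruelle_pow_weight_one_bounds(1)[OF D x] l
        by (intro mult_left_mono) (auto simp: l_def)
      also have "\<dots> = ruelle t (pow_weight q) (\<lambda>_. l ^ n * 1) x"
        by (rule ruelle_scale[OF adm bounded_unit_const x, symmetric])
      also have "\<dots> \<le> iterate t q (Suc n) x"
        unfolding iterate_Suc using Suc
        by (intro ruelle_mono[OF adm _ _ x] iterate_bounded[OF D]) auto
      finally have 1: "l ^ Suc n \<le> iterate t q (Suc n) x" .
      have "iterate t q (Suc n) x \<le> ruelle t (pow_weight q) (\<lambda>_. u ^ n * 1) x"
        unfolding iterate_Suc using Suc
        by (intro ruelle_mono[OF adm _ _ x] iterate_bounded[OF D]) auto
      also have "\<dots> = u ^ n * ruelle t (pow_weight q) (\<lambda>_. 1) x"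
        by (rule ruelle_scale[OF adm bounded_unit_const x])
      also have "\<dots> \<le> u ^ Suc n"
        unfolding power_Suc2 using ruelle_pow_weight_one_bounds(2)[OF D x] u
        by (intro mult_left_mono) (auto simp: u_def)
      finally show "l ^ Suc n \<le> iterate t q (Suc n) x \<and> iterate t q (Suc n) x \<le> u ^ Suc n"
        using 1 by blast
    qed
  qed simp
  then show "(min 1 (4 powr (- t)) * zeta (2 * t - q)) ^ n \<le> iterate t q n x"
    and "iterate t q n x \<le> (max 1 (4 powr (- t)) * zeta (2 * t - q)) ^ n"
    using x unfolding l_def u_def by blast+
qed

lemma iterate_pos:
  assumes D: "1 < 2 * t - q" and x: "x \<in> {0..1}"
  shows "0 < iterate t q n x"
proof -
  have "0 < (min 1 (4 powr (- t)) * zeta (2 * t - q)) ^ n"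
    using zeta_ge_1[OF D] by (intro zero_less_power mult_pos_pos) auto
  then show ?thesis using iterate_bounds(1)[OF D x, of n] by linarith
qed

text \<open>By the Harnack inequality the \<open>m\<close>-th iterate lies below a constant;
  applying the positive operator \<open>n\<close> more times preserves this comparison.\<close>

lemma iterate_add_le:
  assumes D: "1 < 2 * t - q" and x: "x \<in> {0..1}"
  shows "iterate t q (m + n) x \<le> (2 powr (4 * \<bar>t\<bar>) * iterate t q m 0) * iterate t q n x"
proof -
  define C where "C = 2 powr (4 * \<bar>t\<bar>) * iterate t q m 0"
  note adm = pow_weight_admissible[OF D]
  have "\<forall>x\<in>{0..1}. iterate t q (m + n) x \<le> C * iterate t q n x"
  proof (induction n)
    case 0
    show ?case unfolding C_def using log_cone_le[OF iterate_cone[OF D], of _ 0] by simp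
  next
    case (Suc n)
    show ?case
    proof
      fix x :: real assume x: "x \<in> {0..1}"
      have "iterate t q (m + Suc n) x \<le> ruelle t (pow_weight q) (\<lambda>y. C * iterate t q n y) x"
        unfolding add_Suc_right iterate_Suc using Suc
        by (intro ruelle_mono[OF adm _ _ x] bounded_unit_scale iterate_bounded[OF D]) auto
      also have "\<dots> = C * iterate t q (Suc n) x"
        unfolding iterate_Suc by (rule ruelle_scale[OF adm iterate_bounded[OF D] x])
      finally show "iterate t q (m + Suc n) x \<le> C * iterate t q (Suc n) x" .
    qed
  qed
  then show ?thesis using x unfolding C_def by blast
qed

lemma iterate_convergent:
  assumes D: "1 < 2 * t - q"
  shows "convergent (\<lambda>n. ln (iterate t q n 0) / real n)"
proof -
  define K where "K = 2 powr (4 * \<bar>t\<bar>)"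
  define l where "l = min 1 (4 powr (- t)) * zeta (2 * t - q)"
  have K: "1 \<le> K" by (simp add: K_def ge_one_powr_ge_zero)
  have l: "0 < l" using zeta_ge_1[OF D] unfolding l_def by (intro mult_pos_pos) auto
  have pos: "0 < iterate t q n 0" for n using iterate_pos[OF D] by simp
  \<comment> \<open>The extra factor \<open>K\<close> turns submultiplicativity up to a constant
    into genuine subadditivity of the logarithms; it contributes only
    \<open>ln K / n\<close>.\<close>
  have conv: "convergent (\<lambda>n. ln (K * iterate t q n 0) / real n)"
  proof (rule subadditive_convergent[where c = "ln l"])
    fix m n
    have "K * iterate t q (m + n) 0 \<le> (K * iterate t q m 0) * (K * iterate t q n 0)"
      using iterate_add_le[OF D, of 0 m n] K by (simp add: K_def mult_ac)
    then have "ln (K * iterate t q (m + n) 0) \<le> ln ((K * iterate t q m 0) * (K * iterate t q n 0))"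
      using pos K by (intro ln_mono) auto
    also have "\<dots> = ln (K * iterate t q m 0) + ln (K * iterate t q n 0)"
      using pos[of m] pos[of n] K by (intro ln_mult_pos) auto
    finally show "ln (K * iterate t q (m + n) 0) \<le> ln (K * iterate t q m 0) + ln (K * iterate t q n 0)" .
  next
    fix n :: nat assume n: "0 < n"
    have "1 * l ^ n \<le> K * iterate t q n 0"
      using iterate_bounds(1)[OF D, of 0 n] K l by (intro mult_mono) (auto simp: l_def)
    then have "ln (l ^ n) \<le> ln (K * iterate t q n 0)" using l by (intro ln_mono) auto
    then show "ln l \<le> ln (K * iterate t q n 0) / real n"
      using n l by (simp add: ln_realpow field_simps)
  qed
  have "ln (iterate t q n 0) / real n = ln (K * iterate t q n 0) / real n - ln K / real n" for n
    using pos[of n] K by (simp add: ln_mult diff_divide_distrib[symmetric])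
  moreover have "convergent (\<lambda>n. ln K / real n)"
    using lim_const_over_n convergentI by blast
  ultimately show ?thesis using convergent_diff[OF conv] by simp
qed

section \<open>Words, partition sums and the limit defining the pressure\<close>

definition word_weight :: "real \<Rightarrow> real \<Rightarrow> nat list \<Rightarrow> real \<Rightarrow> real" where
  "word_weight t q \<omega> x = (\<Prod>j<length \<omega>. real (\<omega> ! j) powr q * cf (drop j \<omega>) x powr (2 * t))"

text \<open>The last digit is the one next to \<open>x\<close>. Words are therefore extended on the
  right, which matches one further application of \<open>ruelle\<close>, whose terms evaluate the
  previous iterate at \<open>inv_branch k x\<close>.\<close>

lemma cf_snoc: "cf (\<tau> @ [Suc k]) x = cf \<tau> (inv_branch k x)"
  by (induction \<tau>) (auto simp: inv_branch_def)

lemma word_weight_snoc: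
  "word_weight t q (\<tau> @ [Suc k]) x = pow_weight q k * inv_branch k x powr (2 * t) * word_weight t q \<tau> (inv_branch k x)"
proof -
  have "(\<Prod>j<length \<tau>. real ((\<tau> @ [Suc k]) ! j) powr q * cf (drop j (\<tau> @ [Suc k])) x powr (2 * t))
      = word_weight t q \<tau> (inv_branch k x)"
    unfolding word_weight_def by (intro prod.cong) (auto simp: nth_append cf_snoc)
  then show ?thesis
    by (simp add: word_weight_def[of t q "\<tau> @ [Suc k]"] pow_weight_def inv_branch_def mult_ac)
qed

lemma words_0: "words 0 = {[]}"
  by (auto simp: words_def)

lemma words_Suc: "words (Suc n) = (\<lambda>(k, \<tau>). \<tau> @ [Suc k]) ` (UNIV \<times> words n)"
proof (intro equalityI subsetI)
  fix \<omega> assume w: "\<omega> \<in> words (Suc n)"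
  then have "\<omega> \<noteq> []" by (auto simp: words_def)
  then obtain \<tau> a where eq: "\<omega> = \<tau> @ [a]" by (metis rev_exhaust)
  then have "a = Suc (a - 1)" "\<tau> \<in> words n" using w by (auto simp: words_def)
  then show "\<omega> \<in> (\<lambda>(k, \<tau>). \<tau> @ [Suc k]) ` (UNIV \<times> words n)"
    using eq by (intro image_eqI[of _ _ "(a - 1, \<tau>)"]) auto
qed (auto simp: words_def)

text \<open>Bounded distortion for each single word, uniformly in its length; this controls the
  supremum over \<open>x\<close> in the partition sum.\<close>

lemma word_weight_cone:
  "\<omega> \<in> words n \<Longrightarrow> word_weight t q \<omega> \<in> log_cone (4 * \<bar>t\<bar>) \<and> (\<forall>x\<in>{0..1}. 0 < word_weight t q \<omega> x)"
proof (induction n arbitrary: \<omega>)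
  case 0
  then have "word_weight t q \<omega> = (\<lambda>_. 1)" by (auto simp: words_0 word_weight_def)
  then show ?case by (simp add: log_cone_const)
next
  case (Suc n)
  then obtain k \<tau> where \<tau>: "\<omega> = \<tau> @ [Suc k]" "\<tau> \<in> words n" by (auto simp: words_Suc)
  have eq: "word_weight t q \<omega> = (\<lambda>x. pow_weight q k * (inv_branch k x powr (2 * t) * word_weight t q \<tau> (inv_branch k x)))"
    by (auto simp: \<tau>(1) word_weight_snoc fun_eq_iff mult.assoc)
  have "(\<lambda>x. inv_branch k x powr (2 * t) * word_weight t q \<tau> (inv_branch k x)) \<in> log_cone (4 * \<bar>t\<bar> / 2 + 2 * \<bar>t\<bar>)"
    using Suc.IH[OF \<tau>(2)] by (intro log_cone_branch) auto
  then have "word_weight t q \<omega> \<in> log_cone (4 * \<bar>t\<bar>)"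
    unfolding eq by (intro log_cone_scale) (auto simp: pow_weight_def)
  moreover have "0 < word_weight t q \<omega> x" if "x \<in> {0..1}" for x
  proof -
    have "0 < word_weight t q \<tau> (inv_branch k x)" using Suc.IH[OF \<tau>(2)] inv_branch_unit[OF that] by blast
    moreover have "inv_branch k x \<noteq> 0" using inv_branch_pos[OF that, of k] by simp
    ultimately show ?thesis unfolding eq by (simp add: pow_weight_def)
  qed
  ultimately show ?case by blast
qed

text \<open>Induction on the length: the outer sum over the last digit is the series in
  \<open>ruelle\<close>, the inner sum is the hypothesis at \<open>inv_branch k x\<close>.
  Nonnegativity allows passing from the series and the iterated sum to one unordered sum over
  pairs.\<close>

lemma word_weight_has_sum:
  assumes D: "1 < 2 * t - q" and x: "x \<in> {0..1}"
  shows "((\<lambda>\<omega>. word_weight t q \<omega> x) has_sum iterate t q n x) (words n)"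
  using x
proof (induction n arbitrary: x)
  case 0
  show ?case
    using has_sum_finite[of "{[]}" "\<lambda>\<omega>. word_weight t q \<omega> x"] by (simp add: words_0 word_weight_def)
next
  case (Suc n)
  define w where "w k = pow_weight q k * inv_branch k x powr (2 * t)" for k
  have w: "0 \<le> w k" for k by (simp add: w_def pow_weight_def)
  have inner: "((\<lambda>\<tau>. w k * word_weight t q \<tau> (inv_branch k x)) has_sum (w k * iterate t q n (inv_branch k x))) (words n)" for k
    using Suc.IH[OF inv_branch_unit[OF Suc.prems]] by (intro has_sum_cmult_right)
  have outer: "((\<lambda>k. w k * iterate t q n (inv_branch k x)) has_sum iterate t q (Suc n) x) UNIV"
  proof (rule sums_nonneg_imp_has_sum)
    show "(\<lambda>k. w k * iterate t q n (inv_branch k x)) sums iterate t q (Suc n) x"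
      using summable_sums[OF ruelle_summable[OF pow_weight_admissible[OF D] iterate_bounded[OF D] Suc.prems]]
      by (simp add: ruelle_def w_def)
    show "0 \<le> w k * iterate t q n (inv_branch k x)" for k
      using w iterate_pos[OF D inv_branch_unit[OF Suc.prems]] by (simp add: less_imp_le)
  qed
  have "((\<lambda>(k, \<tau>). w k * word_weight t q \<tau> (inv_branch k x)) has_sum iterate t q (Suc n) x) (UNIV \<times> words n)"
  proof (rule has_sum_SigmaI)
    show "((\<lambda>\<tau>. (\<lambda>(k, \<tau>). w k * word_weight t q \<tau> (inv_branch k x)) (k, \<tau>)) has_sum
        (w k * iterate t q n (inv_branch k x))) (words n)" for k
      using inner[of k] by simp
    show "(\<lambda>(k, \<tau>). w k * word_weight t q \<tau> (inv_branch k x)) summable_on (UNIV \<times> words n)"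
    proof (rule summable_on_SigmaI)
      show "(\<lambda>k. w k * iterate t q n (inv_branch k x)) summable_on UNIV"
        using outer by (rule has_sum_imp_summable)
      show "0 \<le> (case (k, \<tau>) of (k, \<tau>) \<Rightarrow> w k * word_weight t q \<tau> (inv_branch k x))" if "\<tau> \<in> words n" for k \<tau>
        using w[of k] log_cone_nonneg[OF conjunct1[OF word_weight_cone[OF that]] inv_branch_unit[OF Suc.prems]] by simp
    qed (use inner in simp)
  qed (rule outer)
  moreover have "inj_on (\<lambda>(k, \<tau>). \<tau> @ [Suc k]) (UNIV \<times> words n)"
    by (auto simp: inj_on_def)
  ultimately show ?case
    unfolding words_Suc
    by (subst has_sum_reindex) (auto simp: o_def case_prod_unfold word_weight_snoc w_def)
qed

text \<open>For each word the exponential of the supremum lies between the weight at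
  \<open>0\<close> and \<open>K\<close> times that weight, by bounded distortion; the bounds are
  then summed over all words.\<close>

lemma partition_sum_bounds:
  assumes D: "1 < 2 * t - q"
  shows "iterate t q n 0 \<le> partition_sum n t q"
    and "partition_sum n t q \<le> 2 powr (4 * \<bar>t\<bar>) * iterate t q n 0"
proof -
  define K where "K = 2 powr (4 * \<bar>t\<bar>)"
  define S where "S \<omega> = exp (SUP x\<in>{0..1}. ln (word_weight t q \<omega> x))" for \<omega>
  have S: "word_weight t q \<omega> 0 \<le> S \<omega> \<and> S \<omega> \<le> K * word_weight t q \<omega> 0" if "\<omega> \<in> words n" for \<omega>
  proof -
    have pos: "0 < word_weight t q \<omega> x" if "x \<in> {0..1}" for x
      using word_weight_cone[OF \<open>\<omega> \<in> words n\<close>] that by blast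
    have K: "0 < K" by (simp add: K_def)
    have ub: "ln (word_weight t q \<omega> x) \<le> ln (K * word_weight t q \<omega> 0)" if "x \<in> {0..1}" for x
      using log_cone_le[OF conjunct1[OF word_weight_cone[OF \<open>\<omega> \<in> words n\<close>]], of t x 0 q] that pos[OF that]
      unfolding K_def by (intro ln_mono) auto
    have "ln (word_weight t q \<omega> 0) \<le> (SUP x\<in>{0..1}. ln (word_weight t q \<omega> x))"
      using ub by (intro cSUP_upper bdd_aboveI2) auto
    moreover have "(SUP x\<in>{0..1}. ln (word_weight t q \<omega> x)) \<le> ln (K * word_weight t q \<omega> 0)"
      using ub by (intro cSUP_least) auto
    moreover have "exp (ln (word_weight t q \<omega> 0)) = word_weight t q \<omega> 0"
      "exp (ln (K * word_weight t q \<omega> 0)) = K * word_weight t q \<omega> 0"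
      using pos[of 0] K by (simp_all add: exp_ln)
    ultimately show ?thesis unfolding S_def by (metis exp_le_cancel_iff)
  qed
  have eq: "partition_sum n t q = infsum S (words n)"
    unfolding partition_sum_def S_def word_weight_def by (intro infsum_cong) (auto simp: words_def)
  have w: "((\<lambda>\<omega>. word_weight t q \<omega> 0) has_sum iterate t q n 0) (words n)"
    using word_weight_has_sum[OF D] by simp
  then have Kw: "((\<lambda>\<omega>. K * word_weight t q \<omega> 0) has_sum (K * iterate t q n 0)) (words n)"
    by (rule has_sum_cmult_right)
  have "S summable_on words n"
    by (rule summable_on_comparison_test[OF has_sum_imp_summable[OF Kw]]) (use S in \<open>auto simp: S_def\<close>)
  then have Ssum: "(S has_sum partition_sum n t q) (words n)"
    unfolding eq by (rule has_sum_infsum)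
  show "iterate t q n 0 \<le> partition_sum n t q"
    using S by (intro has_sum_mono[OF w Ssum]) auto
  show "partition_sum n t q \<le> 2 powr (4 * \<bar>t\<bar>) * iterate t q n 0"
    unfolding K_def[symmetric] using S by (intro has_sum_mono[OF Ssum Kw]) auto
qed

text \<open>As \<open>P\<close> is defined by \<open>lim\<close>, convergence must be established
  before its value can be used. It is inherited from the iterates, since the factor \<open>K\<close>
  vanishes after taking logarithms and dividing by \<open>n\<close>.\<close>

lemma pressure_tendsto:
  assumes D: "1 < 2 * t - q"
  shows "(\<lambda>n. ln (iterate t q n 0) / real n) \<longlonglongrightarrow> P t q"
proof -
  define K where "K = 2 powr (4 * \<bar>t\<bar>)"
  obtain l where l: "(\<lambda>n. ln (iterate t q n 0) / real n) \<longlonglongrightarrow> l"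
    using iterate_convergent[OF D] by (auto simp: convergent_def)
  have pos: "0 < iterate t q n 0" for n using iterate_pos[OF D] by simp
  have K: "0 < K" by (simp add: K_def)
  have "(\<lambda>n. 1 / real n * ln (partition_sum n t q)) \<longlonglongrightarrow> l"
  proof (rule tendsto_sandwich)
    \<comment> \<open>This and the next comparison hold at \<open>n = 0\<close> too, where all
      quotients are \<open>0\<close> by the convention for division by zero.\<close>
    show "\<forall>\<^sub>F n in sequentially. ln (iterate t q n 0) / real n \<le> 1 / real n * ln (partition_sum n t q)"
      using partition_sum_bounds(1)[OF D] pos by (intro always_eventually allI) (auto intro!: divide_right_mono ln_mono)
    show "\<forall>\<^sub>F n in sequentially. 1 / real n * ln (partition_sum n t q) \<le> ln K / real n + ln (iterate t q n 0) / real n"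
    proof (intro always_eventually allI)
      fix n
      have "0 < partition_sum n t q" using partition_sum_bounds(1)[OF D, of n] pos[of n] by linarith
      then have "ln (partition_sum n t q) \<le> ln (K * iterate t q n 0)"
        using partition_sum_bounds(2)[OF D, of n] unfolding K_def by (intro ln_mono) auto
      also have "\<dots> = ln K + ln (iterate t q n 0)" using K pos[of n] by (intro ln_mult_pos) auto
      finally show "1 / real n * ln (partition_sum n t q) \<le> ln K / real n + ln (iterate t q n 0) / real n"
        by (simp add: divide_right_mono flip: add_divide_distrib)
    qed
    show "(\<lambda>n. ln K / real n + ln (iterate t q n 0) / real n) \<longlonglongrightarrow> l"
      using tendsto_add[OF lim_const_over_n l] by simp
  qed (rule l)
  then have "P t q = l" unfolding P_def by (rule limI)
  then show ?thesis using l by simp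
qed

lemma pressure_bounds:
  assumes D: "1 < 2 * t - q"
  shows "ln (min 1 (4 powr (- t)) * zeta (2 * t - q)) \<le> P t q"
    and "P t q \<le> ln (max 1 (4 powr (- t)) * zeta (2 * t - q))"
proof -
  define l u where "l = min 1 (4 powr (- t)) * zeta (2 * t - q)"
    and "u = max 1 (4 powr (- t)) * zeta (2 * t - q)"
  have l: "0 < l" and u: "0 < u"
    using zeta_ge_1[OF D] unfolding l_def u_def by (auto intro!: mult_pos_pos simp: less_max_iff_disj)
  have pos: "0 < iterate t q n 0" for n using iterate_pos[OF D] by simp
  have "ln l \<le> ln (iterate t q n 0) / real n \<and> ln (iterate t q n 0) / real n \<le> ln u" if n: "0 < n" for n
  proof -
    have "ln (l ^ n) \<le> ln (iterate t q n 0)"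
      using iterate_bounds(1)[OF D, of 0 n] l by (intro ln_mono) (auto simp: l_def)
    moreover have "ln (iterate t q n 0) \<le> ln (u ^ n)"
      using iterate_bounds(2)[OF D, of 0 n] pos[of n] by (intro ln_mono) (auto simp: u_def)
    ultimately show ?thesis using n l u by (simp add: ln_realpow field_simps)
  qed
  then have "\<forall>\<^sub>F n in sequentially. ln l \<le> ln (iterate t q n 0) / real n \<and> ln (iterate t q n 0) / real n \<le> ln u"
    using eventually_gt_at_top[of 0] by (rule eventually_mono[rotated]) blast
  then have "\<forall>\<^sub>F n in sequentially. ln l \<le> ln (iterate t q n 0) / real n"
    "\<forall>\<^sub>F n in sequentially. ln (iterate t q n 0) / real n \<le> ln u"
    by (auto elim: eventually_mono)
  then show "ln (min 1 (4 powr (- t)) * zeta (2 * t - q)) \<le> P t q"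
    and "P t q \<le> ln (max 1 (4 powr (- t)) * zeta (2 * t - q))"
    using tendsto_lowerbound[OF pressure_tendsto[OF D]] tendsto_upperbound[OF pressure_tendsto[OF D]]
    unfolding l_def u_def by auto
qed

subsection \<open>Convexity and differentiability in \<open>q\<close>\<close>

text \<open>The weights \<open>pow_weight q k\<close> are log-linear in \<open>q\<close>, so
  Hoelder's inequality for the series in \<open>ruelle\<close> carries log-convexity from one
  iterate to the next.\<close>

lemma iterate_log_convex:
  assumes D1: "1 < 2 * t - q1" and D2: "1 < 2 * t - q2" and u: "0 \<le> u" "u \<le> 1" and x: "x \<in> {0..1}"
  shows "iterate t ((1 - u) * q1 + u * q2) n x \<le> iterate t q1 n x powr (1 - u) * iterate t q2 n x powr u"
proof -
  define q where "q = (1 - u) * q1 + u * q2"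
  have "q \<le> max q1 q2" unfolding q_def using u by (intro convex_bound_le) auto
  then have D: "1 < 2 * t - q" using D1 D2 by linarith
  have "\<forall>x\<in>{0..1}. iterate t q n x \<le> iterate t q1 n x powr (1 - u) * iterate t q2 n x powr u"
  proof (induction n)
    case (Suc n)
    show ?case
    proof
      fix x :: real assume x: "x \<in> {0..1}"
      define w where "w p k = pow_weight p k * inv_branch k x powr (2 * t) * iterate t p n (inv_branch k x)" for p k
      have pos: "0 < w p k" if "1 < 2 * t - p" for p k
        using iterate_pos[OF that inv_branch_unit[OF x], of n k] inv_branch_pos[OF x, of k] by (simp add: w_def pow_weight_def)
      have sum: "summable (w p)" if "1 < 2 * t - p" for p
        unfolding w_def using ruelle_summable[OF pow_weight_admissible[OF that] iterate_bounded[OF that] x] .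
      have eq: "iterate t p (Suc n) x = suminf (w p)" for p
        by (simp add: ruelle_def w_def[abs_def])
      have le: "w q k \<le> w q1 k powr (1 - u) * w q2 k powr u" for k
      proof -
        define b where "b = inv_branch k x powr (2 * t)"
        have b: "0 < b" using inv_branch_pos[OF x, of k] by (simp add: b_def)
        have "b = b powr (1 - u) * b powr u" using b by (simp flip: powr_add)
        moreover have "pow_weight q k = pow_weight q1 k powr (1 - u) * pow_weight q2 k powr u"
          by (simp add: pow_weight_def powr_powr q_def mult.commute add.commute flip: powr_add)
        moreover have "iterate t q n (inv_branch k x) \<le> iterate t q1 n (inv_branch k x) powr (1 - u) * iterate t q2 n (inv_branch k x) powr u"
          using Suc inv_branch_unit[OF x] by blast
        ultimately have "w q k \<le> (pow_weight q1 k powr (1 - u) * pow_weight q2 k powr u) * (b powr (1 - u) * b powr u) *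
            (iterate t q1 n (inv_branch k x) powr (1 - u) * iterate t q2 n (inv_branch k x) powr u)"
          unfolding w_def b_def[symmetric] using b by (metis mult_left_mono less_imp_le mult_pos_pos powr_gt_zero pow_weight_def of_nat_0_less_iff zero_less_Suc)
        also have "\<dots> = w q1 k powr (1 - u) * w q2 k powr u"
          unfolding w_def b_def[symmetric] using b iterate_pos[OF D1 inv_branch_unit[OF x], of n k] iterate_pos[OF D2 inv_branch_unit[OF x], of n k]
          by (simp add: powr_mult pow_weight_def)
        finally show ?thesis .
      qed
      note H = suminf_Hoelder[of "w q1" "w q2" u, OF pos[OF D1] sum[OF D1] pos[OF D2] sum[OF D2] u]
      show "iterate t q (Suc n) x \<le> iterate t q1 (Suc n) x powr (1 - u) * iterate t q2 (Suc n) x powr u"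
        unfolding eq using suminf_le[OF le sum[OF D] H(1)] H(2) by linarith
    qed
  qed simp
  then show ?thesis using x unfolding q_def by blast
qed

lemma pressure_convex: "convex_on {..<2 * t - 1} (P t)"
proof (rule convex_onI)
  fix u q1 q2 :: real
  assume u: "0 < u" "u < 1" and q: "q1 \<in> {..<2 * t - 1}" "q2 \<in> {..<2 * t - 1}"
  define q where "q = (1 - u) * q1 + u * q2"
  have D1: "1 < 2 * t - q1" and D2: "1 < 2 * t - q2" using q by auto
  have "q \<le> max q1 q2" unfolding q_def using u by (intro convex_bound_le) auto
  then have D: "1 < 2 * t - q" using D1 D2 by linarith
  have "P t q \<le> (1 - u) * P t q1 + u * P t q2"
  proof (rule LIMSEQ_le[OF pressure_tendsto[OF D]])
    show "(\<lambda>n. (1 - u) * (ln (iterate t q1 n 0) / real n) + u * (ln (iterate t q2 n 0) / real n))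
        \<longlonglongrightarrow> (1 - u) * P t q1 + u * P t q2"
      by (intro tendsto_intros pressure_tendsto D1 D2)
    have "ln (iterate t q n 0) / real n
        \<le> (1 - u) * (ln (iterate t q1 n 0) / real n) + u * (ln (iterate t q2 n 0) / real n)" for n
    proof -
      have p: "0 < iterate t q n 0" "0 < iterate t q1 n 0" "0 < iterate t q2 n 0"
        using iterate_pos D D1 D2 by auto
      have "ln (iterate t q n 0) \<le> ln (iterate t q1 n 0 powr (1 - u) * iterate t q2 n 0 powr u)"
        using iterate_log_convex[OF D1 D2, of u 0 n] u p unfolding q_def by (intro ln_mono) auto
      also have "\<dots> = (1 - u) * ln (iterate t q1 n 0) + u * ln (iterate t q2 n 0)"
        using p by (simp add: ln_mult_pos ln_powr)
      finally show ?thesis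
        by (simp add: divide_right_mono flip: add_divide_distrib)
    qed
    then show "\<exists>N. \<forall>n\<ge>N. ln (iterate t q n 0) / real n
        \<le> (1 - u) * (ln (iterate t q1 n 0) / real n) + u * (ln (iterate t q2 n 0) / real n)" by blast
  qed
  then show "P t ((1 - u) *\<^sub>R q1 + u *\<^sub>R q2) \<le> (1 - u) * P t q1 + u * P t q2"
    by (simp add: q_def)
qed simp

section \<open>Second-order expansion in \<open>q\<close>; \<open>log_weight q\<close> is the
  derivative of \<open>pow_weight q\<close>\<close>

definition log_weight :: "real \<Rightarrow> nat \<Rightarrow> real" where
  "log_weight q k = pow_weight q k * ln (real (Suc k))"

lemma ln_le_powr:
  fixes x d :: real
  assumes "0 < d" "1 \<le> x"
  shows "ln x \<le> x powr d / d"
proof -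
  have "d * ln x \<le> exp (d * ln x)" using exp_ge_add_one_self[of "d * ln x"] by linarith
  then show ?thesis using assms by (simp add: powr_def field_simps)
qed

lemma log_weight_nonneg: "0 \<le> log_weight q k"
  by (simp add: log_weight_def pow_weight_def)

text \<open>The exponent \<open>3 * d\<close> is the one required by the quadratic remainder below,
  so that a single weight dominates all error terms.\<close>

lemma log_weight_le:
  assumes "0 < d"
  shows "log_weight q k \<le> (1 / d) * pow_weight (q + 3 * d) k"
proof -
  have "pow_weight q k * ln (real (Suc k)) \<le> pow_weight q k * (real (Suc k) powr (3 * d) / d)"
  proof (intro mult_left_mono)
    have "ln (real (Suc k)) \<le> real (Suc k) powr d / d" using assms by (intro ln_le_powr) auto
    also have "\<dots> \<le> real (Suc k) powr (3 * d) / d" using assms by (intro divide_right_mono powr_mono) auto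
    finally show "ln (real (Suc k)) \<le> real (Suc k) powr (3 * d) / d" .
  qed (simp add: pow_weight_def)
  then show ?thesis by (simp add: log_weight_def pow_weight_def powr_add)
qed

text \<open>Taylor expansion of \<open>m powr h = exp (h * ln m)\<close>. Each of the two logarithms
  in the remainder costs \<open>m powr d / d\<close> and the exponential costs
  \<open>m powr d\<close>, whence \<open>3 * d\<close> and \<open>1 / d\<^sup>2\<close>.\<close>

lemma pow_weight_perturb_le:
  assumes d: "0 < d" and h: "\<bar>h\<bar> \<le> d"
  shows "pow_weight (q + h) k \<le> pow_weight q k + h * log_weight q k + (h\<^sup>2 / d\<^sup>2) * pow_weight (q + 3 * d) k"
proof -
  define m where "m = real (Suc k)"
  have m: "1 \<le> m" by (simp add: m_def)
  define z where "z = h * ln m"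
  have "m powr h = exp z" using m by (simp add: powr_def z_def)
  also have "\<dots> \<le> 1 + z + z\<^sup>2 * exp \<bar>z\<bar>" by (rule exp_le_quadratic_remainder)
  also have "z\<^sup>2 * exp \<bar>z\<bar> \<le> (h\<^sup>2 * (m powr d / d)\<^sup>2) * m powr d"
  proof (intro mult_mono)
    show "z\<^sup>2 \<le> h\<^sup>2 * (m powr d / d)\<^sup>2"
      unfolding z_def power_mult_distrib using ln_le_powr[OF d m] m
      by (intro mult_left_mono power_mono) auto
    show "exp \<bar>z\<bar> \<le> m powr d"
      using h m by (simp add: z_def powr_def abs_mult mult_right_mono)
  qed auto
  also have "(h\<^sup>2 * (m powr d / d)\<^sup>2) * m powr d = (h\<^sup>2 / d\<^sup>2) * m powr (3 * d)"
  proof -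
    have "m powr (3 * d) = (m powr d)\<^sup>2 * m powr d"
      by (simp add: power2_eq_square flip: powr_add)
    then show ?thesis by (simp add: power_divide)
  qed
  finally have "m powr h \<le> 1 + z + (h\<^sup>2 / d\<^sup>2) * m powr (3 * d)" by simp
  then have "m powr q * m powr h \<le> m powr q * (1 + z + (h\<^sup>2 / d\<^sup>2) * m powr (3 * d))"
    by (rule mult_left_mono) simp
  then show ?thesis
    unfolding pow_weight_def log_weight_def m_def[symmetric] by (simp add: powr_add z_def algebra_simps)
qed

text \<open>A function in the cone is comparable to the constant \<open>f 0\<close>, and on
  constants both operators are comparable to values of zeta; so \<open>R\<close> does not depend on
  \<open>f\<close> or \<open>x\<close>.\<close>

lemma ruelle_pow_weight_compare:
  assumes D: "1 < 2 * t - q" and D': "1 < 2 * t - q'" and B: "0 \<le> B"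
  obtains R where "0 < R"
    "\<And>f x. f \<in> log_cone B \<Longrightarrow> x \<in> {0..1} \<Longrightarrow> ruelle t (pow_weight q') f x \<le> R * ruelle t (pow_weight q) f x"
proof -
  define l u where "l = min 1 (4 powr (- t)) * zeta (2 * t - q)"
    and "u = max 1 (4 powr (- t)) * zeta (2 * t - q')"
  have l: "0 < l" and u: "0 < u"
    using zeta_ge_1[OF D] zeta_ge_1[OF D'] unfolding l_def u_def
    by (auto intro!: mult_pos_pos simp: less_max_iff_disj)
  define S where "S = (2::real) powr B"
  have S: "0 < S" by (simp add: S_def)
  show ?thesis
  proof
    show "0 < S * S * u / l" using l u S by simp
    fix f and x :: real assume f: "f \<in> log_cone B" and x: "x \<in> {0..1}"
    note bf = log_cone_bounded_unit[OF f B]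
    have f0: "0 \<le> f 0" using log_cone_nonneg[OF f] by simp
    have "ruelle t (pow_weight q') f x \<le> ruelle t (pow_weight q') (\<lambda>_. S * f 0 * 1) x"
      using log_cone_le[OF f B, of _ 0] by (intro ruelle_mono[OF pow_weight_admissible[OF D'] bf _ x]) (auto simp: S_def)
    also have "\<dots> = S * f 0 * ruelle t (pow_weight q') (\<lambda>_. 1) x"
      by (rule ruelle_scale[OF pow_weight_admissible[OF D'] _ x]) simp
    also have "\<dots> \<le> S * f 0 * u"
      using ruelle_pow_weight_one_bounds(2)[OF D' x] S f0 by (intro mult_left_mono) (auto simp: u_def)
    finally have up: "ruelle t (pow_weight q') f x \<le> S * f 0 * u" .
    have "f 0 / S * l \<le> f 0 / S * ruelle t (pow_weight q) (\<lambda>_. 1) x"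
      using ruelle_pow_weight_one_bounds(1)[OF D x] S f0 by (intro mult_left_mono) (auto simp: l_def)
    also have "\<dots> = ruelle t (pow_weight q) (\<lambda>_. f 0 / S * 1) x"
      by (rule ruelle_scale[OF pow_weight_admissible[OF D] _ x, symmetric]) simp
    also have "\<dots> \<le> ruelle t (pow_weight q) f x"
      using log_cone_le[OF f B, of 0] S
      by (intro ruelle_mono[OF pow_weight_admissible[OF D] _ bf x]) (auto simp: S_def field_simps)
    finally have low: "f 0 / S * l \<le> ruelle t (pow_weight q) f x" .
    have "S * f 0 * u = (S * S * u / l) * (f 0 / S * l)" using l S by (simp add: field_simps)
    also have "\<dots> \<le> (S * S * u / l) * ruelle t (pow_weight q) f x"
      using low l u S by (intro mult_left_mono) auto
    finally show "ruelle t (pow_weight q') f x \<le> (S * S * u / l) * ruelle t (pow_weight q) f x"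
      using up by linarith
  qed
qed

text \<open>
  One of \<open>L v\<close> and \<open>L (W * f - v)\<close> is at least \<open>W / 2 * L f\<close> at \<open>0\<close>, so a fixed proportion of \<open>L f\<close> can be
  split off from it inside the cone. This compensates for the added term \<open>ruelle t (log_weight q) f\<close>, the
  derivative of \<open>ruelle t (pow_weight q) f\<close> in \<open>q\<close>.
\<close>

lemma log_cone_step:
  fixes t q W R :: real
  defines "B \<equiv> 4 * \<bar>t\<bar> + 1"
  assumes adm: "admissible t (pow_weight q)" "admissible t (log_weight q)"
    and f: "f \<in> log_cone B" and v: "v \<in> log_cone (B + 1)" and Wv: "(\<lambda>x. W * f x - v x) \<in> log_cone (B + 1)"
    and R: "0 < R" "ruelle t (log_weight q) f 0 \<le> R * ruelle t (pow_weight q) f 0"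
    and W: "W = 2 * absorb B * absorb B * R"
  obtains \<alpha> where "0 \<le> \<alpha>"
    "(\<lambda>x. ruelle t (pow_weight q) v x + ruelle t (log_weight q) f x - \<alpha> * ruelle t (pow_weight q) f x) \<in> log_cone (B + 1)"
    "(\<lambda>x. W * ruelle t (pow_weight q) f x -
        (ruelle t (pow_weight q) v x + ruelle t (log_weight q) f x - \<alpha> * ruelle t (pow_weight q) f x)) \<in> log_cone (B + 1)"
proof -
  define K where "K = absorb B"
  have B: "0 \<le> B" by (simp add: B_def)
  have K: "1 \<le> K" unfolding K_def by (rule absorb_ge_1[OF B])
  have W0: "0 < W" using K R W unfolding K_def by simp
  define F G H where "F = ruelle t (pow_weight q) f" and "G = ruelle t (pow_weight q) v" and "H = ruelle t (log_weight q) f"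
  \<comment> \<open>With \<open>B = 4 * |t| + 1\<close> the operator maps
    \<open>log_cone (B + 1)\<close> into \<open>log_cone B\<close>; this gap of 1 is what
    \<open>log_cone_absorb\<close> consumes.\<close>
  have half: "(B + 1) / 2 + 2 * \<bar>t\<bar> = B" by (simp add: B_def)
  have fB: "f \<in> log_cone (B + 1)" using f by (rule log_cone_mono) simp
  have smooth: "ruelle t c g \<in> log_cone B" if "admissible t c" "g \<in> log_cone (B + 1)" for c g
    using log_cone_ruelle[OF that] B unfolding half by simp
  have F: "F \<in> log_cone B" unfolding F_def by (rule smooth[OF adm(1) fB])
  have G: "G \<in> log_cone B" unfolding G_def by (rule smooth[OF adm(1) v])
  have H: "H \<in> log_cone B" unfolding H_def by (rule smooth[OF adm(2) fB])
  have bf: "bounded_unit f" and bv: "bounded_unit v"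
    using log_cone_bounded_unit[OF f] log_cone_bounded_unit[OF v] B by auto
  have G2: "(\<lambda>x. W * F x - G x) \<in> log_cone B"
  proof (rule log_cone_cong)
    show "ruelle t (pow_weight q) (\<lambda>x. W * f x - v x) \<in> log_cone B" by (rule smooth[OF adm(1) Wv])
    fix x :: real assume x: "x \<in> {0..1}"
    have "ruelle t (pow_weight q) (\<lambda>x. W * f x + (- 1) * v x) x = W * F x + (- 1) * G x"
      unfolding F_def G_def
      using ruelle_add[OF adm(1) bounded_unit_scale[OF bf] bounded_unit_scale[OF bv] x]
      by (simp only: ruelle_scale[OF adm(1) bf x] ruelle_scale[OF adm(1) bv x])
    then show "W * F x - G x = ruelle t (pow_weight q) (\<lambda>x. W * f x - v x) x" by simp
  qed
  have KRH: "(\<lambda>x. K * (R * F x) - H x) \<in> log_cone (B + 1)"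
    unfolding K_def using R by (intro log_cone_absorb[OF H log_cone_scale[OF F] B]) (auto simp: F_def H_def)
  \<comment> \<open>Absorption allows splitting off \<open>W / (2 * K)\<close> times
    \<open>F\<close>. The choice of \<open>W\<close> makes this equal to \<open>K * R * F\<close>,
    the multiple that dominates \<open>H\<close> in \<open>KRH\<close>.\<close>
  have absorbed: "(\<lambda>x. g x - K * R * F x) \<in> log_cone (B + 1)" if g: "g \<in> log_cone B" "W / 2 * F 0 \<le> g 0" for g
  proof (rule log_cone_cong)
    have "(\<lambda>x. K * g x - W / 2 * F x) \<in> log_cone (B + 1)"
      unfolding K_def using W0 g by (intro log_cone_absorb[OF log_cone_scale[OF F] _ B]) auto
    then show "(\<lambda>x. 1 / K * (K * g x - W / 2 * F x)) \<in> log_cone (B + 1)"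
      using K by (intro log_cone_scale) auto
    show "g x - K * R * F x = 1 / K * (K * g x - W / 2 * F x)" for x
      using K unfolding W K_def[symmetric] by (simp add: field_simps)
  qed
  show ?thesis
  \<comment> \<open>If \<open>G\<close> is large at \<open>0\<close>, the multiple is taken out of
    \<open>G\<close> and \<open>\<alpha> = K * R\<close> records it; otherwise it is taken out of
    \<open>W * F - G\<close> and the correction simply grows by \<open>H\<close>.\<close>
  proof (cases "W / 2 * F 0 \<le> G 0")
    case True
    show ?thesis
    proof (rule that[of "K * R"])
      show "0 \<le> K * R" using K R by simp
      have "(\<lambda>x. (G x - K * R * F x) + H x) \<in> log_cone (B + 1)"
        by (rule log_cone_add[OF absorbed[OF G True] log_cone_mono[OF H]]) simp
      then show "(\<lambda>x. ruelle t (pow_weight q) v x + ruelle t (log_weight q) f x - K * R * ruelle t (pow_weight q) f x) \<in> log_cone (B + 1)"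
        by (rule log_cone_cong) (simp add: F_def G_def H_def)
      have "(\<lambda>x. (W * F x - G x) + (K * (R * F x) - H x)) \<in> log_cone (B + 1)"
        by (rule log_cone_add[OF log_cone_mono[OF G2] KRH]) simp
      then show "(\<lambda>x. W * ruelle t (pow_weight q) f x -
          (ruelle t (pow_weight q) v x + ruelle t (log_weight q) f x - K * R * ruelle t (pow_weight q) f x)) \<in> log_cone (B + 1)"
        by (rule log_cone_cong) (simp add: F_def G_def H_def)
    qed
  next
    case False
    then have G20: "W / 2 * F 0 \<le> W * F 0 - G 0" by (simp add: field_simps)
    show ?thesis
    proof (rule that[of 0])
      have "(\<lambda>x. G x + H x) \<in> log_cone (B + 1)"
        by (rule log_cone_add[OF log_cone_mono[OF G] log_cone_mono[OF H]]) simp_all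
      then show "(\<lambda>x. ruelle t (pow_weight q) v x + ruelle t (log_weight q) f x - 0 * ruelle t (pow_weight q) f x) \<in> log_cone (B + 1)"
        by (rule log_cone_cong) (simp add: F_def G_def H_def)
      have "(\<lambda>x. (W * F x - G x - K * R * F x) + (K * (R * F x) - H x)) \<in> log_cone (B + 1)"
        by (rule log_cone_add[OF absorbed[OF G2 G20] KRH])
      then show "(\<lambda>x. W * ruelle t (pow_weight q) f x -
          (ruelle t (pow_weight q) v x + ruelle t (log_weight q) f x - 0 * ruelle t (pow_weight q) f x)) \<in> log_cone (B + 1)"
        by (rule log_cone_cong) (simp add: F_def G_def H_def)
    qed simp
  qed
qed

text \<open>As \<open>|h * v|\<close> is at most \<open>F / 2\<close>, the quadratic error is at
  most \<open>2 * C * h\<^sup>2\<close> times \<open>F + h * v\<close>. The cross term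
  \<open>h\<^sup>2 * \<alpha> * v\<close> has the favourable sign for either sign of
  \<open>h\<close>.\<close>

lemma first_order_le_exp:
  fixes F v W h \<alpha> C :: real
  assumes v: "0 \<le> v" "v \<le> W * F" and h: "\<bar>h\<bar> * W \<le> 1 / 2" and F: "0 \<le> F" and \<alpha>: "0 \<le> \<alpha>" and C: "0 \<le> C"
  shows "F + h * v + h * \<alpha> * F + h\<^sup>2 * C * F \<le> exp (h * \<alpha> + 2 * C * h\<^sup>2) * (F + h * v)"
proof -
  have "\<bar>h * v\<bar> \<le> \<bar>h\<bar> * (W * F)" using v by (simp add: abs_mult mult_left_mono)
  also have "\<dots> \<le> 1 / 2 * F" using mult_right_mono[OF h F] by (simp add: mult.assoc)
  finally have hv: "F / 2 \<le> F + h * v" by (simp add: abs_le_iff)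
  have "(C * h\<^sup>2) * F \<le> 2 * (C * h\<^sup>2) * (F + h * v)"
    using mult_left_mono[OF hv, of "2 * (C * h\<^sup>2)"] C by simp
  moreover have "0 \<le> \<alpha> * (h\<^sup>2 * v)" using \<alpha> v by simp
  ultimately have "F + h * v + h * \<alpha> * F + h\<^sup>2 * C * F \<le> (1 + (h * \<alpha> + 2 * C * h\<^sup>2)) * (F + h * v)"
    by (simp add: algebra_simps power2_eq_square)
  also have "\<dots> \<le> exp (h * \<alpha> + 2 * C * h\<^sup>2) * (F + h * v)"
    using hv F by (intro mult_right_mono exp_ge_add_one_self) auto
  finally show ?thesis .
qed

text \<open>The weight is expanded to second order in \<open>h\<close>. Two terms of order
  \<open>h\<^sup>2\<close> arise: the first-order weight acting on \<open>h * v\<close>, bounded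
  through \<open>v \<le> W * f\<close>, and the Taylor remainder acting on
  \<open>f + h * v \<le> 2 * f\<close>.\<close>

lemma perturb_step:
  assumes adm: "admissible t (pow_weight q)" "admissible t (log_weight q)" "admissible t (pow_weight (q + h))" "admissible t (pow_weight (q + 3 * d))"
    and f: "bounded_unit f" "\<And>x. x \<in> {0..1} \<Longrightarrow> 0 \<le> f x"
    and v: "bounded_unit v" "\<And>x. x \<in> {0..1} \<Longrightarrow> 0 \<le> v x" "\<And>x. x \<in> {0..1} \<Longrightarrow> v x \<le> W * f x"
    and x: "x \<in> {0..1}"
    and R: "0 \<le> R" "ruelle t (log_weight q) f x \<le> R * ruelle t (pow_weight q) f x"
      "ruelle t (pow_weight (q + 3 * d)) f x \<le> R * ruelle t (pow_weight q) f x"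
    and d: "0 < d" and h: "\<bar>h\<bar> \<le> d" "\<bar>h\<bar> * W \<le> 1 / 2" and W: "0 \<le> W"
  shows "ruelle t (pow_weight (q + h)) (\<lambda>y. f y + h * v y) x \<le>
      ruelle t (pow_weight q) f x + h * (ruelle t (pow_weight q) v x + ruelle t (log_weight q) f x)
        + h\<^sup>2 * (W * R + 2 * R / d\<^sup>2) * ruelle t (pow_weight q) f x"
proof -
  have hv: "\<bar>h * v y\<bar> \<le> f y / 2" if "y \<in> {0..1}" for y
  proof -
    have "\<bar>h * v y\<bar> \<le> \<bar>h\<bar> * (W * f y)" using v(2,3)[OF that] by (simp add: abs_mult mult_left_mono)
    also have "\<dots> \<le> 1 / 2 * f y" using mult_right_mono[OF h(2) f(2)[OF that]] by (simp add: mult.assoc)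
    finally show ?thesis by simp
  qed
  define g where "g = (\<lambda>y. f y + h * v y)"
  have bg: "bounded_unit g" unfolding g_def by (intro bounded_unit_add bounded_unit_scale f v)
  have g: "0 \<le> g y" "g y \<le> 2 * f y" if "y \<in> {0..1}" for y
    using hv[OF that] f(2)[OF that] by (auto simp: g_def abs_le_iff)
  have lin: "ruelle t c g x = ruelle t c f x + h * ruelle t c v x" if "admissible t c" for c
    unfolding g_def ruelle_add[OF that f(1) bounded_unit_scale[OF v(1)] x]
    by (simp only: ruelle_scale[OF that v(1) x])
  have "ruelle t (log_weight q) v x \<le> ruelle t (log_weight q) (\<lambda>y. W * f y) x"
    using v f by (intro ruelle_mono[OF adm(2) _ _ x]) auto
  also have "\<dots> = W * ruelle t (log_weight q) f x" by (rule ruelle_scale[OF adm(2) f(1) x])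
  also have "\<dots> \<le> W * (R * ruelle t (pow_weight q) f x)" using R W by (intro mult_left_mono) auto
  finally have L1: "h\<^sup>2 * ruelle t (log_weight q) v x \<le> h\<^sup>2 * (W * (R * ruelle t (pow_weight q) f x))"
    by (intro mult_left_mono) auto
  have "ruelle t (pow_weight (q + 3 * d)) g x \<le> ruelle t (pow_weight (q + 3 * d)) (\<lambda>y. 2 * f y) x"
    using g(2) bg f by (intro ruelle_mono[OF adm(4) _ _ x]) auto
  also have "\<dots> = 2 * ruelle t (pow_weight (q + 3 * d)) f x" by (rule ruelle_scale[OF adm(4) f(1) x])
  also have "\<dots> \<le> 2 * (R * ruelle t (pow_weight q) f x)" using R by simp
  finally have L3: "h\<^sup>2 / d\<^sup>2 * ruelle t (pow_weight (q + 3 * d)) g x \<le> h\<^sup>2 / d\<^sup>2 * (2 * (R * ruelle t (pow_weight q) f x))"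
    by (intro mult_left_mono) auto
  have "ruelle t (pow_weight (q + h)) g x \<le> ruelle t (pow_weight q) g x + h * ruelle t (log_weight q) g x
      + h\<^sup>2 / d\<^sup>2 * ruelle t (pow_weight (q + 3 * d)) g x"
    using g(1) by (intro ruelle_weight_le adm bg x pow_weight_perturb_le d h)
  also have "\<dots> = ruelle t (pow_weight q) f x + h * (ruelle t (pow_weight q) v x + ruelle t (log_weight q) f x)
      + h\<^sup>2 * ruelle t (log_weight q) v x + h\<^sup>2 / d\<^sup>2 * ruelle t (pow_weight (q + 3 * d)) g x"
    by (simp add: lin[OF adm(1)] lin[OF adm(2)] algebra_simps power2_eq_square)
  also have "\<dots> \<le> ruelle t (pow_weight q) f x + h * (ruelle t (pow_weight q) v x + ruelle t (log_weight q) f x)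
      + h\<^sup>2 * (W * (R * ruelle t (pow_weight q) f x)) + h\<^sup>2 / d\<^sup>2 * (2 * (R * ruelle t (pow_weight q) f x))"
    using L1 L3 by linarith
  also have "\<dots> = ruelle t (pow_weight q) f x + h * (ruelle t (pow_weight q) v x + ruelle t (log_weight q) f x)
        + h\<^sup>2 * (W * R + 2 * R / d\<^sup>2) * ruelle t (pow_weight q) f x"
    by (simp add: algebra_simps)
  finally show ?thesis unfolding g_def .
qed

text \<open>The number \<open>\<sigma>\<close> may depend on \<open>n\<close> but not on
  \<open>h\<close>, so that it cancels between \<open>h\<close> and \<open>- h\<close>. It is the
  sum of the numbers \<open>\<alpha>\<close> supplied by \<open>log_cone_step\<close>.\<close>

lemma iterate_second_order:
  assumes D: "1 < 2 * t - q"
  obtains r C where "0 < r"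
    "\<And>n. \<exists>\<sigma>. \<forall>h x. \<bar>h\<bar> \<le> r \<longrightarrow> x \<in> {0..1} \<longrightarrow>
        iterate t (q + h) n x \<le> exp (h * \<sigma> + real n * (C * h\<^sup>2)) * (2 * iterate t q n x)"
    "r < 2 * t - q - 1"
proof -
  \<comment> \<open>A quarter of the distance to the boundary, so that \<open>q + 3 * d\<close>
    stays in the domain.\<close>
  define d where "d = (2 * t - q - 1) / 4"
  have d: "0 < d" using D by (simp add: d_def)
  have D3: "1 < 2 * t - (q + 3 * d)" using D by (simp add: d_def field_simps)
  have Dh: "1 < 2 * t - (q + h)" if "\<bar>h\<bar> \<le> d" for h
    using that D unfolding d_def by (auto simp: field_simps abs_le_iff)
  have adm3: "admissible t (pow_weight (q + 3 * d))" by (rule pow_weight_admissible[OF D3])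
  have adm: "admissible t (pow_weight q)" by (rule pow_weight_admissible[OF D])
  have adml: "admissible t (log_weight q)"
    using d by (intro admissible_mono[OF admissible_scale[OF adm3] log_weight_nonneg log_weight_le]) auto
  define B where "B = 4 * \<bar>t\<bar> + 1"
  have B: "0 \<le> B" by (simp add: B_def)
  obtain R0 where R0: "0 < R0"
    "\<And>f x. f \<in> log_cone B \<Longrightarrow> x \<in> {0..1} \<Longrightarrow> ruelle t (pow_weight (q + 3 * d)) f x \<le> R0 * ruelle t (pow_weight q) f x"
    using ruelle_pow_weight_compare[OF D D3 B] by blast
  \<comment> \<open>One constant for both comparisons: it dominates \<open>R0\<close> for the weight
    at \<open>q + 3 * d\<close> and \<open>R0 / d\<close> for \<open>log_weight\<close>.\<close>
  define R where "R = R0 * (1 + 1 / d)"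
  have R: "0 < R" using R0 d by (simp add: R_def add_pos_pos)
  have nonneg: "0 \<le> ruelle t (pow_weight q) f x" if "f \<in> log_cone B" "x \<in> {0..1}" for f x
    using ruelle_nonneg[OF adm log_cone_bounded_unit[OF that(1) B] that(2)] log_cone_nonneg[OF that(1)] by blast
  have R3: "ruelle t (pow_weight (q + 3 * d)) f x \<le> R * ruelle t (pow_weight q) f x"
    if "f \<in> log_cone B" "x \<in> {0..1}" for f x
  proof -
    have "R0 \<le> R" using R0 d by (simp add: R_def)
    then show ?thesis using R0(2)[OF that] mult_right_mono[OF _ nonneg[OF that]] by fastforce
  qed
  have Rl: "ruelle t (log_weight q) f x \<le> R * ruelle t (pow_weight q) f x"
    if "f \<in> log_cone B" "x \<in> {0..1}" for f x
  proof -
    have f: "bounded_unit f" "\<And>y. y \<in> {0..1} \<Longrightarrow> 0 \<le> f y"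
      using log_cone_bounded_unit[OF that(1) B] log_cone_nonneg[OF that(1)] by auto
    \<comment> \<open>The zero weight and the coefficient \<open>0\<close> fill the other two places
      of \<open>ruelle_weight_le\<close>.\<close>
    have "ruelle t (log_weight q) f x \<le> ruelle t (\<lambda>_. 0) f x + (1 / d) * ruelle t (pow_weight (q + 3 * d)) f x
        + 0 * ruelle t (pow_weight q) f x"
      using log_weight_le[OF d, of q] f
      by (intro ruelle_weight_le adml adm adm3 that) (auto simp: admissible_def)
    also have "\<dots> \<le> (1 / d) * (R0 * ruelle t (pow_weight q) f x)"
      using mult_left_mono[OF R0(2)[OF that], of "1 / d"] d by (simp add: ruelle_def)
    also have "\<dots> \<le> R * ruelle t (pow_weight q) f x"
    proof -
      have "1 / d * R0 \<le> R" using R0 d by (simp add: R_def algebra_simps)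
      then show ?thesis using mult_right_mono[OF _ nonneg[OF that]] by (fastforce simp: mult.assoc)
    qed
    finally show ?thesis .
  qed
  define W where "W = 2 * absorb B * absorb B * R"
  have W: "0 < W" using absorb_ge_1[OF B] R by (simp add: W_def)
  define C where "C = W * R + 2 * R / d\<^sup>2"
  have C: "0 \<le> C" using W R by (simp add: C_def)
  \<comment> \<open>Ensures both the Taylor estimate for \<open>|h| \<le> d\<close> and
    \<open>|h| * W \<le> 1 / 2\<close>.\<close>
  define r where "r = min d (1 / (2 * W))"
  have r: "0 < r" "r \<le> d" using d W by (auto simp: r_def)
  have hr: "\<bar>h\<bar> \<le> d \<and> \<bar>h\<bar> * W \<le> 1 / 2" if "\<bar>h\<bar> \<le> r" for h
    using that W by (auto simp: r_def field_simps)
  have fB: "iterate t q n \<in> log_cone B" for n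
    by (rule log_cone_mono[OF iterate_cone[OF D]]) (simp add: B_def)
  \<comment> \<open>The invariant keeps \<open>v\<close> between \<open>0\<close> and
    \<open>W\<close> times the iterate in the cone order, with \<open>W\<close> independent of
    \<open>n\<close>; pointwise bounds alone would not feed \<open>log_cone_step\<close>.\<close>
  have main: "\<exists>v \<sigma>. v \<in> log_cone (B + 1) \<and> (\<lambda>x. W * iterate t q n x - v x) \<in> log_cone (B + 1) \<and>
      (\<forall>h. \<bar>h\<bar> \<le> r \<longrightarrow> (\<forall>x\<in>{0..1}. iterate t (q + h) n x \<le>
        exp (h * \<sigma> + real n * (2 * C * h\<^sup>2)) * (iterate t q n x + h * v x)))" for n
  proof (induction n)
    case 0
    show ?case
      using B W by (intro exI[of _ "\<lambda>_. 0"] exI[of _ 0]) (auto simp: log_cone_const)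
  next
    case (Suc n)
    define f where "f = iterate t q n"
    obtain v \<sigma> where v: "v \<in> log_cone (B + 1)" and Wv: "(\<lambda>x. W * f x - v x) \<in> log_cone (B + 1)"
      and IH: "\<And>h x. \<bar>h\<bar> \<le> r \<Longrightarrow> x \<in> {0..1} \<Longrightarrow> iterate t (q + h) n x \<le>
        exp (h * \<sigma> + real n * (2 * C * h\<^sup>2)) * (f x + h * v x)"
      using Suc unfolding f_def by blast
    have f: "f \<in> log_cone B" using fB by (simp add: f_def)
    have R0': "ruelle t (log_weight q) f 0 \<le> R * ruelle t (pow_weight q) f 0" using Rl[OF f] by simp
    obtain \<alpha> where \<alpha>: "0 \<le> \<alpha>"
      "(\<lambda>x. ruelle t (pow_weight q) v x + ruelle t (log_weight q) f x - \<alpha> * ruelle t (pow_weight q) f x) \<in> log_cone (B + 1)"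
      "(\<lambda>x. W * ruelle t (pow_weight q) f x -
          (ruelle t (pow_weight q) v x + ruelle t (log_weight q) f x - \<alpha> * ruelle t (pow_weight q) f x)) \<in> log_cone (B + 1)"
      using log_cone_step[OF adm adml f[unfolded B_def] v[unfolded B_def] Wv[unfolded B_def] R R0' W_def[unfolded B_def]]
      unfolding B_def[symmetric] by blast
    \<comment> \<open>The new correction. The removed multiple of the iterate moves into the
      exponential, where \<open>\<alpha>\<close> is added to \<open>\<sigma>\<close>.\<close>
    let ?v = "\<lambda>x. ruelle t (pow_weight q) v x + ruelle t (log_weight q) f x - \<alpha> * ruelle t (pow_weight q) f x"
    have bf: "bounded_unit f" and bv: "bounded_unit v"
      using log_cone_bounded_unit[OF f] log_cone_bounded_unit[OF v] B by auto
    have step: "iterate t (q + h) (Suc n) x \<le> exp (h * (\<sigma> + \<alpha>) + real (Suc n) * (2 * C * h\<^sup>2)) *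
        (iterate t q (Suc n) x + h * ?v x)" if h: "\<bar>h\<bar> \<le> r" and x: "x \<in> {0..1}" for h x
    proof -
      define E where "E = exp (h * \<sigma> + real n * (2 * C * h\<^sup>2))"
      define F where "F = ruelle t (pow_weight q) f x"
      have admh: "admissible t (pow_weight (q + h))" using hr[OF h] by (intro pow_weight_admissible Dh) auto
      have bfv: "bounded_unit (\<lambda>y. f y + h * v y)" by (intro bounded_unit_add bounded_unit_scale bf bv)
      have "iterate t (q + h) (Suc n) x \<le> ruelle t (pow_weight (q + h)) (\<lambda>y. E * (f y + h * v y)) x"
        unfolding iterate_Suc E_def
        using IH[OF h] hr[OF h] by (intro ruelle_mono[OF admh _ _ x] bounded_unit_scale bfv iterate_bounded Dh) auto
      also have "\<dots> = E * ruelle t (pow_weight (q + h)) (\<lambda>y. f y + h * v y) x"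
        by (rule ruelle_scale[OF admh bfv x])
      also have "\<dots> \<le> E * (F + h * (ruelle t (pow_weight q) v x + ruelle t (log_weight q) f x) + h\<^sup>2 * C * F)"
        unfolding F_def C_def
        using hr[OF h] log_cone_nonneg[OF f] log_cone_nonneg[OF v] log_cone_nonneg[OF Wv] R W
        by (intro mult_left_mono perturb_step[OF adm adml admh adm3 bf _ bv _ _ x _ Rl[OF f x] R3[OF f x] d])
           (auto simp: E_def)
      also have "\<dots> = E * (F + h * ?v x + h * \<alpha> * F + h\<^sup>2 * C * F)"
        by (simp add: F_def algebra_simps)
      also have "\<dots> \<le> E * (exp (h * \<alpha> + 2 * C * h\<^sup>2) * (F + h * ?v x))"
        using hr[OF h] log_cone_nonneg[OF \<alpha>(2) x] log_cone_nonneg[OF \<alpha>(3) x] nonneg[OF f x] \<alpha>(1) C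
        by (intro mult_left_mono first_order_le_exp[where W = W]) (auto simp: E_def F_def)
      also have "\<dots> = exp (h * (\<sigma> + \<alpha>) + real (Suc n) * (2 * C * h\<^sup>2)) * (F + h * ?v x)"
        by (simp add: E_def algebra_simps flip: exp_add)
      finally show ?thesis by (simp add: F_def f_def)
    qed
    show ?case
      by (rule exI[of _ ?v], rule exI[of _ "\<sigma> + \<alpha>"]) (use \<alpha> step in \<open>auto simp: f_def\<close>)
  qed
  show ?thesis
  proof
    show "0 < r" by (rule r)
    show "r < 2 * t - q - 1" using r d by (simp add: d_def)
    fix n
    obtain v \<sigma> where v: "v \<in> log_cone (B + 1)" "(\<lambda>x. W * iterate t q n x - v x) \<in> log_cone (B + 1)"
      and le: "\<And>h x. \<bar>h\<bar> \<le> r \<Longrightarrow> x \<in> {0..1} \<Longrightarrow> iterate t (q + h) n x \<le>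
        exp (h * \<sigma> + real n * (2 * C * h\<^sup>2)) * (iterate t q n x + h * v x)"
      using main[of n] by blast
    have "iterate t (q + h) n x \<le> exp (h * \<sigma> + real n * (2 * C * h\<^sup>2)) * (2 * iterate t q n x)"
      if h: "\<bar>h\<bar> \<le> r" and x: "x \<in> {0..1}" for h x
    proof -
      have p: "0 \<le> iterate t q n x" using iterate_pos[OF D x] by (simp add: less_imp_le)
      have "h * v x \<le> \<bar>h\<bar> * v x" using log_cone_nonneg[OF v(1) x] by (intro mult_right_mono) auto
      also have "\<dots> \<le> \<bar>h\<bar> * (W * iterate t q n x)"
        using log_cone_nonneg[OF v(2) x] by (intro mult_left_mono) auto
      also have "\<dots> \<le> 1 / 2 * iterate t q n x"
        using mult_right_mono[OF conjunct2[OF hr[OF h]] p] by (simp add: mult.assoc)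
      finally have "iterate t q n x + h * v x \<le> 2 * iterate t q n x" using p by linarith
      then show ?thesis using le[OF h x] by (meson exp_ge_zero mult_left_mono order.trans)
    qed
    then show "\<exists>\<sigma>. \<forall>h x. \<bar>h\<bar> \<le> r \<longrightarrow> x \<in> {0..1} \<longrightarrow>
        iterate t (q + h) n x \<le> exp (h * \<sigma> + real n * (2 * C * h\<^sup>2)) * (2 * iterate t q n x)"
      by blast
  qed
qed

text \<open>Adding the logarithmic estimates for \<open>h\<close> and \<open>- h\<close> cancels
  \<open>\<sigma>\<close>. After division by \<open>n\<close> the prefactor 2 disappears in the
  limit, leaving the quadratic second-difference bound.\<close>

lemma pressure_has_derivative:
  assumes D: "1 < 2 * t - q"
  shows "\<exists>D. (P t has_real_derivative D) (at q)"
proof -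
  obtain r C where r: "0 < r" "r < 2 * t - q - 1" and second:
    "\<And>n. \<exists>\<sigma>. \<forall>h x. \<bar>h\<bar> \<le> r \<longrightarrow> x \<in> {0..1} \<longrightarrow>
        iterate t (q + h) n x \<le> exp (h * \<sigma> + real n * (C * h\<^sup>2)) * (2 * iterate t q n x)"
    using iterate_second_order[OF D] by metis
  show ?thesis
  proof (rule convex_has_derivative_of_second_difference[OF pressure_convex _ r(1)])
    show "q < 2 * t - 1" using D by simp
    fix h assume h: "0 < h" "h < r"
    have Dp: "1 < 2 * t - (q + h)" and Dm: "1 < 2 * t - (q - h)" using h r D by linarith+
    have le: "ln (iterate t (q + h) n 0) / real n + ln (iterate t (q - h) n 0) / real n - 2 * (ln (iterate t q n 0) / real n)
        \<le> 2 * C * h\<^sup>2 + 2 * ln 2 / real n" if n: "0 < n" for n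
    proof -
      obtain \<sigma> where \<sigma>: "\<And>h. \<bar>h\<bar> \<le> r \<Longrightarrow>
          iterate t (q + h) n 0 \<le> exp (h * \<sigma> + real n * (C * h\<^sup>2)) * (2 * iterate t q n 0)"
        using second[of n] by force
      have pos: "0 < iterate t q n 0" "0 < iterate t (q + h) n 0" "0 < iterate t (q - h) n 0"
        using iterate_pos D Dp Dm by auto
      have up: "ln (iterate t (q + k) n 0) \<le> k * \<sigma> + real n * (C * k\<^sup>2) + (ln 2 + ln (iterate t q n 0))"
        if "\<bar>k\<bar> \<le> r" "0 < iterate t (q + k) n 0" for k
      proof -
        have "ln (iterate t (q + k) n 0) \<le> ln (exp (k * \<sigma> + real n * (C * k\<^sup>2)) * (2 * iterate t q n 0))"
          using \<sigma>[OF that(1)] that(2) by (intro ln_mono) auto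
        also have "\<dots> = k * \<sigma> + real n * (C * k\<^sup>2) + (ln 2 + ln (iterate t q n 0))"
          using pos(1) by (simp add: ln_mult_pos)
        finally show ?thesis .
      qed
      have "ln (iterate t (q + h) n 0) + ln (iterate t (q - h) n 0) - 2 * ln (iterate t q n 0)
          \<le> 2 * (real n * (C * h\<^sup>2)) + 2 * ln 2"
        using up[of h] up[of "- h"] h pos by simp
      then have "(ln (iterate t (q + h) n 0) + ln (iterate t (q - h) n 0) - 2 * ln (iterate t q n 0)) / real n
          \<le> (2 * (real n * (C * h\<^sup>2)) + 2 * ln 2) / real n"
        by (rule divide_right_mono) simp
      then show ?thesis using n by (simp add: add_divide_distrib diff_divide_distrib)
    qed
    show "P t (q + h) + P t (q - h) - 2 * P t q \<le> (2 * C) * h\<^sup>2"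
    proof (rule LIMSEQ_le)
      show "(\<lambda>n. ln (iterate t (q + h) n 0) / real n + ln (iterate t (q - h) n 0) / real n
          - 2 * (ln (iterate t q n 0) / real n)) \<longlonglongrightarrow> P t (q + h) + P t (q - h) - 2 * P t q"
        by (intro tendsto_intros pressure_tendsto D Dp Dm)
      show "(\<lambda>n. 2 * C * h\<^sup>2 + 2 * ln 2 / real n) \<longlonglongrightarrow> (2 * C) * h\<^sup>2"
        using tendsto_add[OF tendsto_const lim_const_over_n] by simp
      show "\<exists>N. \<forall>n\<ge>N. ln (iterate t (q + h) n 0) / real n + ln (iterate t (q - h) n 0) / real n
          - 2 * (ln (iterate t q n 0) / real n) \<le> 2 * C * h\<^sup>2 + 2 * ln 2 / real n"
        using le by (intro exI[of _ 1]) auto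
    qed
  qed
qed

subsection \<open>Boundary behaviour\<close>

lemma zeta_antimono:
  assumes "1 < s" "s \<le> s'"
  shows "zeta s' \<le> zeta s"
  unfolding zeta_def using assms by (intro suminf_le zeta_summable powr_mono) auto

text \<open>Finite partial sums are continuous in \<open>s\<close> and bound zeta from below; at
  \<open>s = 1\<close> they are harmonic sums and exceed any \<open>Z\<close>.\<close>

lemma zeta_at_top: "filterlim zeta at_top (at_right 1)"
  unfolding filterlim_at_top
proof
  fix Z :: real
  have "\<exists>N. Z < (\<Sum>k<N. 1 / real (Suc k))"
  proof (rule ccontr)
    assume "\<not> ?thesis"
    then have "summable (\<lambda>k. 1 / real (Suc k))"
      by (intro bounded_imp_summable[where B = Z])
        (auto simp: not_less lessThan_Suc_atMost[symmetric] simp del: sum.lessThan_Suc)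
    then have "summable (\<lambda>k. inverse (real k))"
      by (subst summable_Suc_iff[symmetric]) (simp add: inverse_eq_divide)
    then show False using not_summable_harmonic by blast
  qed
  then obtain N where N: "Z < (\<Sum>k<N. 1 / real (Suc k))" by blast
  have "((\<lambda>s. \<Sum>k<N. real (Suc k) powr (- s)) \<longlongrightarrow> (\<Sum>k<N. real (Suc k) powr (- 1))) (at_right 1)"
    by (intro tendsto_intros) auto
  moreover have "(\<Sum>k<N. real (Suc k) powr (- 1)) = (\<Sum>k<N. 1 / real (Suc k))"
    by (intro sum.cong) (auto simp: powr_minus_divide)
  ultimately have "\<forall>\<^sub>F s in at_right 1. Z < (\<Sum>k<N. real (Suc k) powr (- s))"
    using N by (metis order_tendstoD(1))
  then show "\<forall>\<^sub>F s in at_right 1. Z \<le> zeta s"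
    using eventually_at_right_less
  proof eventually_elim
    case (elim s)
    have "(\<Sum>k<N. real (Suc k) powr (- s)) \<le> zeta s"
      unfolding zeta_def using zeta_summable[OF elim(2)] by (intro sum_le_suminf) auto
    then show ?case using elim(1) by linarith
  qed
qed

section \<open>Bounds by zeta for each sign of \<open>t\<close>, and blow-up at the boundary
  line\<close>

lemma pressure_bounds_pos:
  assumes D: "1 < 2 * t - q" and t: "0 \<le> t"
  shows "- t * ln 4 + ln (zeta (2 * t - q)) \<le> P t q" "P t q \<le> ln (zeta (2 * t - q))"
proof -
  have "4 powr (- t) \<le> 1" using powr_mono[of "- t" 0 4] t by simp
  then have m: "min 1 (4 powr (- t)) = 4 powr (- t)" "max 1 (4 powr (- t)) = 1" by auto
  show "- t * ln 4 + ln (zeta (2 * t - q)) \<le> P t q" "P t q \<le> ln (zeta (2 * t - q))"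
    using pressure_bounds[OF D, unfolded m] zeta_ge_1[OF D] by (simp_all add: ln_mult_pos ln_powr)
qed

text \<open>For negative \<open>t\<close> the power \<open>2 * t\<close> reverses order, so the term
  \<open>- t * ln 4\<close>, now positive, moves to the upper bound.\<close>

lemma pressure_bounds_neg:
  assumes D: "1 < 2 * t - q" and t: "t < 0"
  shows "ln (zeta (2 * t - q)) \<le> P t q" "P t q \<le> - t * ln 4 + ln (zeta (2 * t - q))"
proof -
  have "1 \<le> 4 powr (- t)" using powr_mono[of 0 "- t" 4] t by simp
  then have m: "min 1 (4 powr (- t)) = 1" "max 1 (4 powr (- t)) = 4 powr (- t)" by auto
  show "ln (zeta (2 * t - q)) \<le> P t q" "P t q \<le> - t * ln 4 + ln (zeta (2 * t - q))"
    using pressure_bounds[OF D, unfolded m] zeta_ge_1[OF D] by (simp_all add: ln_mult_pos ln_powr)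
qed

lemma pressure_abs_bounds:
  assumes D: "1 < 2 * t - q"
  shows "ln (zeta (2 * t - q)) - \<bar>t\<bar> * ln 4 \<le> P t q" "P t q \<le> ln (zeta (2 * t - q)) + \<bar>t\<bar> * ln 4"
proof -
  have "0 \<le> \<bar>t\<bar> * ln 4" by simp
  then show "ln (zeta (2 * t - q)) - \<bar>t\<bar> * ln 4 \<le> P t q" "P t q \<le> ln (zeta (2 * t - q)) + \<bar>t\<bar> * ln 4"
    using pressure_bounds_pos[OF D] pressure_bounds_neg[OF D] by (cases "0 \<le> t"; simp)+
qed

text \<open>Within \<open>D\<close> the quantity \<open>2 * t - q\<close> tends to 1 from the right,
  so the zeta term diverges while \<open>|t| * ln 4\<close> stays bounded near
  \<open>t\<^sub>0\<close>.\<close>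

lemma pressure_at_top:
  assumes line: "2 * t\<^sub>0 - q\<^sub>0 = 1"
  shows "filterlim (\<lambda>(t, q). P t q) at_top (at (t\<^sub>0, q\<^sub>0) within D)"
proof -
  let ?F = "at (t\<^sub>0, q\<^sub>0) within D"
  have inD: "\<forall>\<^sub>F p in ?F. p \<in> D" by (simp add: eventually_at_filter)
  have id: "((\<lambda>p. p) \<longlongrightarrow> (t\<^sub>0, q\<^sub>0)) ?F" by (rule tendsto_ident_at)
  have "((\<lambda>p. 2 * fst p - snd p) \<longlongrightarrow> 2 * fst (t\<^sub>0, q\<^sub>0) - snd (t\<^sub>0, q\<^sub>0)) ?F"
    by (intro tendsto_intros id)
  then have "filterlim (\<lambda>p. 2 * fst p - snd p) (at_right 1) ?F"
    using inD line unfolding filterlim_at by (auto simp: D_def elim!: eventually_mono)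
  then have "filterlim (\<lambda>p. ln (zeta (2 * fst p - snd p))) at_top ?F"
    by (intro filterlim_compose[OF ln_at_top] filterlim_compose[OF zeta_at_top])
  moreover have "((\<lambda>p. - (\<bar>fst p\<bar> * ln 4)) \<longlongrightarrow> - (\<bar>fst (t\<^sub>0, q\<^sub>0)\<bar> * ln 4)) ?F"
    by (intro tendsto_intros id)
  ultimately have "filterlim (\<lambda>p. - (\<bar>fst p\<bar> * ln 4) + ln (zeta (2 * fst p - snd p))) at_top ?F"
    by (intro filterlim_tendsto_add_at_top)
  then show ?thesis
  proof (rule filterlim_at_top_mono)
    show "\<forall>\<^sub>F p in ?F. - (\<bar>fst p\<bar> * ln 4) + ln (zeta (2 * fst p - snd p)) \<le> (case p of (t, q) \<Rightarrow> P t q)"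
      using inD
    proof eventually_elim
      case (elim p)
      then show ?case
        using pressure_abs_bounds(1)[of "fst p" "snd p"] by (auto simp: D_def)
    qed
  qed
qed

section \<open>Limits of the derivative from the tangent inequality\<close>

lemma pressure_above_tangent:
  assumes D: "1 < 2 * t - q" and D': "1 < 2 * t - q'"
  shows "deriv (P t) q * (q' - q) \<le> P t q' - P t q"
proof -
  obtain d where d: "(P t has_real_derivative d) (at q)" using pressure_has_derivative[OF D] by blast
  have "P t q' - P t q \<ge> d * (q' - q)"
    using D D' d
    by (intro convex_on_imp_above_tangent[OF pressure_convex])
       (auto simp: interior_open intro: has_field_derivative_at_within)
  then show ?thesis using DERIV_imp_deriv[OF d] by simp
qed

lemma pressure_deriv_at_top: "filterlim (deriv (P t)) at_top (at_left (2 * t - 1))"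
proof -
  let ?F = "at_left (2 * t - 1)"
  \<comment> \<open>A fixed point at distance 1 from the boundary, so that
    \<open>0 < q - q1 < 1\<close> near the boundary.\<close>
  define q1 where "q1 = 2 * t - 2"
  have "filterlim (\<lambda>q. 2 * t - q) (at_right 1) ?F"
  proof -
    have "((\<lambda>q. 2 * t - q) \<longlongrightarrow> 2 * t - (2 * t - 1)) ?F" by (intro tendsto_intros)
    moreover have "\<forall>\<^sub>F q in ?F. 2 * t - q \<in> {1<..} \<and> 2 * t - q \<noteq> 1"
      by (auto simp: eventually_at_filter)
    ultimately show ?thesis unfolding filterlim_at by simp
  qed
  then have "filterlim (\<lambda>q. ln (zeta (2 * t - q))) at_top ?F"
    by (intro filterlim_compose[OF ln_at_top] filterlim_compose[OF zeta_at_top])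
  then have lim: "filterlim (\<lambda>q. (- \<bar>t\<bar> * ln 4 - \<bar>P t q1\<bar>) + ln (zeta (2 * t - q))) at_top ?F"
    by (rule filterlim_tendsto_add_at_top[OF tendsto_const])
  have near: "\<forall>\<^sub>F q in ?F. q1 < q \<and> q < 2 * t - 1"
    unfolding eventually_at_left_field by (intro exI[of _ q1]) (simp add: q1_def)
  have "\<forall>\<^sub>F q in ?F. 0 \<le> (- \<bar>t\<bar> * ln 4 - \<bar>P t q1\<bar>) + ln (zeta (2 * t - q))"
    using lim by (simp add: filterlim_at_top)
  with near have "\<forall>\<^sub>F q in ?F. (- \<bar>t\<bar> * ln 4 - \<bar>P t q1\<bar>) + ln (zeta (2 * t - q)) \<le> deriv (P t) q"
  proof eventually_elim
    case (elim q)
    have D: "1 < 2 * t - q" and D1: "1 < 2 * t - q1" using elim(1) by (auto simp: q1_def)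
    have "deriv (P t) q * (q1 - q) \<le> P t q1 - P t q" by (rule pressure_above_tangent[OF D D1])
    then have a: "P t q - P t q1 \<le> deriv (P t) q * (q - q1)" by (simp add: algebra_simps)
    have b: "(- \<bar>t\<bar> * ln 4 - \<bar>P t q1\<bar>) + ln (zeta (2 * t - q)) \<le> P t q - P t q1"
      using pressure_abs_bounds(1)[OF D] by linarith
    with a elim have "0 \<le> deriv (P t) q * (q - q1)" by linarith
    \<comment> \<open>Nonnegativity of the derivative permits replacing the factor
      \<open>q - q1 < 1\<close> by 1.\<close>
    then have "0 \<le> deriv (P t) q" using elim(1) by (simp add: zero_le_mult_iff)
    then have "deriv (P t) q * (q - q1) \<le> deriv (P t) q * 1"
      using elim(1) by (intro mult_left_mono) (auto simp: q1_def)
    then show ?case using a b by linarith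
  qed
  then show ?thesis by (rule filterlim_at_top_mono[OF lim])
qed

text \<open>Here \<open>2 * t - q\<close> is at least 2, so zeta lies between 1 and
  \<open>zeta 2\<close>.\<close>

lemma pressure_bounded_at_bot:
  obtains C where "\<And>q. q \<le> 2 * t - 2 \<Longrightarrow> \<bar>P t q\<bar> \<le> C"
proof
  fix q assume q: "q \<le> 2 * t - 2"
  then have D: "1 < 2 * t - q" by simp
  have "0 \<le> ln (zeta (2 * t - q))" "ln (zeta (2 * t - q)) \<le> ln (zeta 2)"
    using zeta_ge_1[OF D] zeta_antimono[of 2 "2 * t - q"] q by (auto intro: ln_mono)
  then show "\<bar>P t q\<bar> \<le> ln (zeta 2) + \<bar>t\<bar> * ln 4"
    using pressure_abs_bounds[OF D] by (simp add: abs_le_iff)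
qed

lemma pressure_over_at_bot: "((\<lambda>q. P t q / q) \<longlongrightarrow> 0) at_bot"
proof -
  obtain C where C: "\<And>q. q \<le> 2 * t - 2 \<Longrightarrow> \<bar>P t q\<bar> \<le> C"
    using pressure_bounded_at_bot by blast
  have "((\<lambda>q. C * \<bar>inverse q\<bar>) \<longlongrightarrow> C * \<bar>0\<bar>) at_bot"
    by (intro tendsto_intros filterlim_compose[OF tendsto_inverse_0] at_bot_le_at_infinity[THEN filterlim_mono[OF filterlim_ident _ order_refl]])
  then have lim: "((\<lambda>q. C * \<bar>inverse q\<bar>) \<longlongrightarrow> 0) at_bot" by simp
  show ?thesis
  proof (rule Lim_null_comparison[OF _ lim])
    show "\<forall>\<^sub>F q in at_bot. norm (P t q / q) \<le> C * \<bar>inverse q\<bar>"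
      using eventually_le_at_bot[of "2 * t - 2"]
    proof eventually_elim
      case (elim q)
      show ?case using mult_right_mono[OF C[OF elim], of "\<bar>inverse q\<bar>"]
        by (simp add: divide_inverse abs_mult)
    qed
  qed
qed

lemma pressure_deriv_at_bot: "(deriv (P t) \<longlongrightarrow> 0) at_bot"
proof -
  define b where "b = 2 * t - 2"
  obtain C where C: "\<And>q. q \<le> b \<Longrightarrow> \<bar>P t q\<bar> \<le> C"
    using pressure_bounded_at_bot unfolding b_def by blast
  have "filterlim (\<lambda>q. b - q) at_top at_bot"
    unfolding filterlim_at_top_dense
  proof
    fix Z
    show "\<forall>\<^sub>F q in at_bot. Z < b - q"
      using eventually_gt_at_bot[of "b - Z"] by eventually_elim simp
  qed
  then have "((\<lambda>q. 2 * C * inverse (b - q)) \<longlongrightarrow> 2 * C * 0) at_bot"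
    by (intro tendsto_intros filterlim_compose[OF tendsto_inverse_0_at_top filterlim_ident] tendsto_inverse_0_at_top)
  then have lim: "((\<lambda>q. 2 * C * inverse (b - q)) \<longlongrightarrow> 0) at_bot" by simp
  show ?thesis
  proof (rule Lim_null_comparison[OF _ lim])
    show "\<forall>\<^sub>F q in at_bot. norm (deriv (P t) q) \<le> 2 * C * inverse (b - q)"
      using eventually_gt_at_bot[of b]
    proof eventually_elim
      case (elim q)
      \<comment> \<open>The point \<open>2 * q - b\<close> is the reflection of \<open>b\<close> in
        \<open>q\<close>. The tangent inequality at these two points bounds the derivative from
        above and below by \<open>2 * C / (b - q)\<close>.\<close>
      have D: "1 < 2 * t - q" "1 < 2 * t - b" "1 < 2 * t - (2 * q - b)"
        using elim by (auto simp: b_def)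
      have "deriv (P t) q * (b - q) \<le> P t b - P t q" "deriv (P t) q * (2 * q - b - q) \<le> P t (2 * q - b) - P t q"
        using pressure_above_tangent D by blast+
      moreover have "\<bar>P t b\<bar> \<le> C" "\<bar>P t q\<bar> \<le> C" "\<bar>P t (2 * q - b)\<bar> \<le> C" using C elim by auto
      ultimately have "\<bar>deriv (P t) q * (b - q)\<bar> \<le> 2 * C"
        by (simp add: abs_le_iff algebra_simps)
      then have "\<bar>deriv (P t) q\<bar> * (b - q) \<le> 2 * C" using elim by (simp add: abs_mult)
      then show ?case using elim by (simp add: field_simps)
    qed
  qed
qed

text \<open>The bounds are split by the sign of \<open>t\<close>, because the comparison of
  \<open>k + x\<close> with \<open>k\<close> and \<open>2 * k\<close> reverses under the power
  \<open>- 2 * t\<close> when \<open>t < 0\<close>.\<close>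

theorem proposition4p12:
  shows
    "(\<forall>t q. (t, q) \<in> D \<longrightarrow>
        (0 \<le> t \<longrightarrow> - t * ln 4 + ln (zeta (2 * t - q)) \<le> P t q \<and> P t q \<le> ln (zeta (2 * t - q))) \<and>
        (t < 0 \<longrightarrow> ln (zeta (2 * t - q)) \<le> P t q \<and> P t q \<le> - t * ln 4 + ln (zeta (2 * t - q))))
     \<and> (\<forall>q. (0, q) \<in> D \<longrightarrow> P 0 q = ln (zeta (- q)))
     \<and> (\<forall>t\<^sub>0 q\<^sub>0. 2 * t\<^sub>0 - q\<^sub>0 = 1 \<longrightarrow>
          filterlim (\<lambda>(t, q). P t q) at_top (at (t\<^sub>0, q\<^sub>0) within D))
     \<and> (\<forall>t. filterlim (\<lambda>q. deriv (\<lambda>q'. P t q') q) at_top (at_left (2 * t - 1)))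
     \<and> (\<forall>t. ((\<lambda>q. P t q / q) \<longlongrightarrow> 0) at_bot \<and>
            ((\<lambda>q. deriv (\<lambda>q'. P t q') q) \<longlongrightarrow> 0) at_bot)"
proof (intro conjI allI impI)
  fix t q :: real assume "(t, q) \<in> D"
  then have D: "1 < 2 * t - q" by (simp add: D_def)
  show "- t * ln 4 + ln (zeta (2 * t - q)) \<le> P t q" "P t q \<le> ln (zeta (2 * t - q))" if "0 \<le> t"
    using pressure_bounds_pos[OF D that] .
  show "ln (zeta (2 * t - q)) \<le> P t q" "P t q \<le> - t * ln 4 + ln (zeta (2 * t - q))" if "t < 0"
    using pressure_bounds_neg[OF D that] .
next
  fix q :: real assume "(0, q) \<in> D"
  then show "P 0 q = ln (zeta (- q))" using pressure_bounds_pos[of 0 q] by (simp add: D_def)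
qed (simp_all add: pressure_at_top pressure_deriv_at_top pressure_over_at_bot pressure_deriv_at_bot)

end
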